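(* Let $k$ be a field, let $e\ge2$ and $n\ge2$ be integers, let $S=k[x_1,\dots,x_e]$ and $\mathfrak n=(x_1,\dots,x_e)$, and let $R=S/\mathfrak n^n$, an artinian local ring with maximal ideal $\mathfrak m=\mathfrak n/\mathfrak n^n$ and residue field $k$. Let $E$ be the injective envelope of $k$ over $R$ and $E^*=\operatorname{Hom}_R(E,R)$. Then $\mathfrak mE^*=0$ and $$\dim_k(E^* )=\binom{e+n-2}{n-1}^2.$$ *)

theory Defs
  imports
    "HOL-Library.Poly_Mapping"
    "HOL-Library.Cardinality"
    "HOL-Algebra.Algebra"
    "Jordan_Normal_Form.VS_Connect"
begin

text \<open>
  \<open>HOL-Algebra\<close> modules over a commutative ring; homomorphisms (\<open>module_hom\<close>), submodules and the
  dimension of a vector space are those of the theories \<open>LinearCombinations\<close> and \<open>VectorSpace\<close>.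
  The \<open>mult\<close> and \<open>one\<close> fields of a \<open>module\<close> record play no role in the locale \<open>module\<close>.
\<close>

definition regular_module :: "('a, 'r) ring_scheme \<Rightarrow> ('a, 'a) module" where
  "regular_module R =
     \<lparr>carrier = carrier R,
      monoid.mult = monoid.mult R, monoid.one = monoid.one R,
      ring.zero = ring.zero R, ring.add = ring.add R,
      module.smult = monoid.mult R\<rparr>"

definition residue_module :: "('a, 'r) ring_scheme \<Rightarrow> 'a set \<Rightarrow> ('a, 'a set) module" where
  "residue_module R I =
     \<lparr>carrier = carrier (R Quot I),
      monoid.mult = monoid.mult (R Quot I), monoid.one = monoid.one (R Quot I),
      ring.zero = ring.zero (R Quot I), ring.add = ring.add (R Quot I),
      module.smult = (\<lambda>r x. (I +>\<^bsub>R\<^esub> r) \<otimes>\<^bsub>R Quot I\<^esub> x)\<rparr>"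

text \<open>Homomorphisms are taken extensional, so that equal maps on the carrier are equal elements.\<close>

definition Hom_module ::
  "('a, 'r) ring_scheme \<Rightarrow> ('a, 'b, 'm) module_scheme \<Rightarrow> ('a, 'c, 'n) module_scheme \<Rightarrow>
   ('a, 'b \<Rightarrow> 'c) module" where
  "Hom_module R M N =
     \<lparr>carrier = LinearCombinations.module_hom R M N \<inter> extensional (carrier M),
      monoid.mult = undefined, monoid.one = undefined,
      ring.zero = (\<lambda>x\<in>carrier M. \<zero>\<^bsub>N\<^esub>),
      ring.add = (\<lambda>f g. \<lambda>x\<in>carrier M. f x \<oplus>\<^bsub>N\<^esub> g x),
      module.smult = (\<lambda>r f. \<lambda>x\<in>carrier M. r \<odot>\<^bsub>N\<^esub> f x)\<rparr>"

definition restrict_scalars ::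
  "('c \<Rightarrow> 'a) \<Rightarrow> ('a, 'b, 'm) module_scheme \<Rightarrow> ('c, 'b) module" where
  "restrict_scalars \<phi> M =
     \<lparr>carrier = carrier M,
      monoid.mult = monoid.mult M, monoid.one = monoid.one M,
      ring.zero = ring.zero M, ring.add = ring.add M,
      module.smult = (\<lambda>c x. \<phi> c \<odot>\<^bsub>M\<^esub> x)\<rparr>"

text \<open>
  A definition cannot quantify over types, so the test modules \<open>A\<close> and \<open>B\<close> have their elements in
  the element type of the ring. This is no restriction: by the lemma \<open>injective_module_extend\<close>
  below, the extension property then holds for test modules over arbitrary types.
\<close>

definition injective_module ::
  "('a, 'r) ring_scheme \<Rightarrow> ('a, 'b, 'm) module_scheme \<Rightarrow> bool" where
  "injective_module R E \<longleftrightarrow> module R E \<and>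
     (\<forall>(A :: ('a, 'a) module) (B :: ('a, 'a) module).
        \<forall>i \<in> LinearCombinations.module_hom R A B. \<forall>g \<in> LinearCombinations.module_hom R A E.
          module R A \<longrightarrow> module R B \<longrightarrow> inj_on i (carrier A) \<longrightarrow>
          (\<exists>h \<in> LinearCombinations.module_hom R B E. \<forall>x \<in> carrier A. h (i x) = g x))"

definition essential_submodule ::
  "('a, 'r) ring_scheme \<Rightarrow> 'b set \<Rightarrow> ('a, 'b, 'm) module_scheme \<Rightarrow> bool" where
  "essential_submodule R L E \<longleftrightarrow> LinearCombinations.submodule R L E \<and>
     (\<forall>N. LinearCombinations.submodule R N E \<longrightarrow> N \<inter> L = {\<zero>\<^bsub>E\<^esub>} \<longrightarrow> N = {\<zero>\<^bsub>E\<^esub>})"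

definition injective_envelope ::
  "('a, 'r) ring_scheme \<Rightarrow> ('a, 'c, 'n) module_scheme \<Rightarrow> ('a, 'b, 'm) module_scheme \<Rightarrow> bool" where
  "injective_envelope R M E \<longleftrightarrow> module R M \<and> injective_module R E \<and>
     (\<exists>i \<in> LinearCombinations.module_hom R M E.
        inj_on i (carrier M) \<and> essential_submodule R (i ` carrier M) E)"

text \<open>
  Multivariate polynomials with variables indexed by \<open>'v\<close>: finitely supported coefficient functions
  on the exponent vectors, multiplied by convolution.
\<close>

type_synonym ('v, 'k) mpoly = "('v \<Rightarrow>\<^sub>0 nat) \<Rightarrow>\<^sub>0 'k"

definition mpoly_ring :: "('v::finite, 'k::field) mpoly ring" where
  "mpoly_ring = class_ring"

definition mpoly_var :: "'v \<Rightarrow> ('v::finite, 'k::field) mpoly" where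
  "mpoly_var i = Poly_Mapping.single (Poly_Mapping.single i 1) 1"

definition mpoly_const :: "'k \<Rightarrow> ('v::finite, 'k::field) mpoly" where
  "mpoly_const c = Poly_Mapping.single 0 c"


lemma module_regular_module:
  assumes "cring R"
  shows "module R (regular_module R)"
proof -
  interpret cring R by fact
  have "abelian_group (regular_module R)"
    by (rule abelian_groupI) (auto simp: regular_module_def a_ac intro: bexI[of _ "\<ominus>\<^bsub>R\<^esub> _"] l_neg)
  then show ?thesis
    by (intro module.intro assms module_axioms.intro)
      (auto simp: regular_module_def l_distr r_distr m_assoc)
qed

lemma injective_module_extend:
  fixes R :: "('a, 'r) ring_scheme" and E :: "('a, 'b, 'm) module_scheme"
    and A :: "('a, 'c, 'n) module_scheme" and B :: "('a, 'd, 'o) module_scheme"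
  assumes inj: "injective_module R E" and A: "module R A" and B: "module R B"
    and i: "i \<in> LinearCombinations.module_hom R A B" and i_inj: "inj_on i (carrier A)"
    and g: "g \<in> LinearCombinations.module_hom R A E"
  shows "\<exists>h \<in> LinearCombinations.module_hom R B E. \<forall>x \<in> carrier A. h (i x) = g x"
proof -
  interpret R: cring R using A by (simp add: module_def)
  interpret E: module R E using inj by (simp add: injective_module_def)
  interpret A: module R A by fact
  interpret B: module R B by fact
  define G0 where "G0 = (\<lambda>a. (i a, g a)) ` carrier A"
  define P where "P = {G. G \<subseteq> carrier B \<times> carrier E \<and> G0 \<subseteq> G \<and>
     (\<forall>x y x' y'. (x, y) \<in> G \<longrightarrow> (x', y') \<in> G \<longrightarrow> (x \<oplus>\<^bsub>B\<^esub> x', y \<oplus>\<^bsub>E\<^esub> y') \<in> G) \<and>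
     (\<forall>r x y. r \<in> carrier R \<longrightarrow> (x, y) \<in> G \<longrightarrow> (r \<odot>\<^bsub>B\<^esub> x, r \<odot>\<^bsub>E\<^esub> y) \<in> G) \<and>
     (\<forall>x y y'. (x, y) \<in> G \<longrightarrow> (x, y') \<in> G \<longrightarrow> y = y')}"
  have P_add: "(x \<oplus>\<^bsub>B\<^esub> x', y \<oplus>\<^bsub>E\<^esub> y') \<in> G" if "G \<in> P" "(x, y) \<in> G" "(x', y') \<in> G" for G x y x' y'
    using that by (simp add: P_def)
  have P_smult: "(r \<odot>\<^bsub>B\<^esub> x, r \<odot>\<^bsub>E\<^esub> y) \<in> G" if "G \<in> P" "r \<in> carrier R" "(x, y) \<in> G" for G r x y
    using that by (simp add: P_def)
  have P_sv: "y = y'" if "G \<in> P" "(x, y) \<in> G" "(x, y') \<in> G" for G x y y'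
  proof -
    have "\<forall>x y y'. (x, y) \<in> G \<longrightarrow> (x, y') \<in> G \<longrightarrow> y = y'"
      using that(1) by (simp add: P_def)
    with that(2,3) show ?thesis by blast
  qed
  have P_sub: "G \<subseteq> carrier B \<times> carrier E" "G0 \<subseteq> G" if "G \<in> P" for G
    using that by (simp_all add: P_def)
  have P_I: "G \<in> P" if "G \<subseteq> carrier B \<times> carrier E" "G0 \<subseteq> G"
    "\<And>x y x' y'. (x, y) \<in> G \<Longrightarrow> (x', y') \<in> G \<Longrightarrow> (x \<oplus>\<^bsub>B\<^esub> x', y \<oplus>\<^bsub>E\<^esub> y') \<in> G"
    "\<And>r x y. r \<in> carrier R \<Longrightarrow> (x, y) \<in> G \<Longrightarrow> (r \<odot>\<^bsub>B\<^esub> x, r \<odot>\<^bsub>E\<^esub> y) \<in> G"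
    "\<And>x y y'. (x, y) \<in> G \<Longrightarrow> (x, y') \<in> G \<Longrightarrow> y = y'" for G
    unfolding P_def mem_Collect_eq using that by (intro conjI allI impI) assumption+
  have i_im: "i a \<in> carrier B" if "a \<in> carrier A" for a
    using LinearCombinations.module_hom_closed[OF i] that by auto
  have g_im: "g a \<in> carrier E" if "a \<in> carrier A" for a
    using LinearCombinations.module_hom_closed[OF g] that by auto
  have "G0 \<in> P"
  proof -
    have add: "(i a \<oplus>\<^bsub>B\<^esub> i a', g a \<oplus>\<^bsub>E\<^esub> g a') \<in> G0" if "a \<in> carrier A" "a' \<in> carrier A" for a a'
      unfolding G0_def using that
      by (intro image_eqI[of _ _ "a \<oplus>\<^bsub>A\<^esub> a'"])
        (auto simp: LinearCombinations.module_hom_add[OF i] LinearCombinations.module_hom_add[OF g])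
    have sm: "(r \<odot>\<^bsub>B\<^esub> i a, r \<odot>\<^bsub>E\<^esub> g a) \<in> G0" if "r \<in> carrier R" "a \<in> carrier A" for r a
      unfolding G0_def using that
      by (intro image_eqI[of _ _ "r \<odot>\<^bsub>A\<^esub> a"])
        (auto simp: LinearCombinations.module_hom_smult[OF i] LinearCombinations.module_hom_smult[OF g])
    have sub: "G0 \<subseteq> carrier B \<times> carrier E"
      using i_im g_im by (auto simp: G0_def)
    have sv: "y = y'" if "(x, y) \<in> G0" "(x, y') \<in> G0" for x y y'
      using that i_inj by (auto simp: G0_def inj_on_def)
    show ?thesis
    proof (rule P_I)
      show "(x \<oplus>\<^bsub>B\<^esub> x', y \<oplus>\<^bsub>E\<^esub> y') \<in> G0" if "(x, y) \<in> G0" "(x', y') \<in> G0" for x y x' y'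
        using that add unfolding G0_def by auto
      show "(r \<odot>\<^bsub>B\<^esub> x, r \<odot>\<^bsub>E\<^esub> y) \<in> G0" if "r \<in> carrier R" "(x, y) \<in> G0" for r x y
        using that sm unfolding G0_def by auto
    qed (use sub sv in auto)
  qed
  have "\<exists>M\<in>P. \<forall>W\<in>P. M \<subseteq> W \<longrightarrow> W = M"
  proof (rule subset_Zorn_nonempty)
    show "P \<noteq> {}" using \<open>G0 \<in> P\<close> by auto
    fix C assume C: "C \<noteq> {}" "subset.chain P C"
    then have CP: "C \<subseteq> P" and ch: "\<And>W Y. W \<in> C \<Longrightarrow> Y \<in> C \<Longrightarrow> W \<subseteq> Y \<or> Y \<subseteq> W"
      by (auto simp: subset_chain_def)
    have two: "\<exists>W\<in>C. p \<in> W \<and> q \<in> W" if "p \<in> \<Union>C" "q \<in> \<Union>C" for p q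
      using that ch by blast
    have "(x \<oplus>\<^bsub>B\<^esub> x', y \<oplus>\<^bsub>E\<^esub> y') \<in> \<Union>C" if xy: "(x, y) \<in> \<Union>C" "(x', y') \<in> \<Union>C" for x y x' y'
    proof -
      obtain W where "W \<in> C" "(x, y) \<in> W" "(x', y') \<in> W" using two[OF xy] by auto
      moreover from this have "W \<in> P" using CP by auto
      ultimately show ?thesis using P_add by blast
    qed
    moreover have "y = y'" if xy: "(x, y) \<in> \<Union>C" "(x, y') \<in> \<Union>C" for x y y'
    proof -
      obtain W where "W \<in> C" "(x, y) \<in> W" "(x, y') \<in> W" using two[OF xy] by auto
      moreover from this have "W \<in> P" using CP by auto
      ultimately show ?thesis using P_sv by blast
    qed
    moreover have "(r \<odot>\<^bsub>B\<^esub> x, r \<odot>\<^bsub>E\<^esub> y) \<in> \<Union>C" if rx: "r \<in> carrier R" "(x, y) \<in> \<Union>C" for r x y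
    proof -
      obtain W where "W \<in> C" "(x, y) \<in> W" using rx by auto
      moreover from this have "W \<in> P" using CP by auto
      ultimately show ?thesis using rx P_smult by blast
    qed
    moreover have "\<Union>C \<subseteq> carrier B \<times> carrier E"
      using CP P_sub(1) by blast
    moreover have "G0 \<subseteq> \<Union>C"
      using CP C(1) P_sub(2) by blast
    ultimately show "\<Union>C \<in> P" by (intro P_I)
  qed
  then obtain G where GP: "G \<in> P" and G_max: "\<And>W. W \<in> P \<Longrightarrow> G \<subseteq> W \<Longrightarrow> W = G" by blast
  have G_sub: "x \<in> carrier B" "y \<in> carrier E" if "(x, y) \<in> G" for x y
    using P_sub(1)[OF GP] that by auto
  have G0_G: "(i a, g a) \<in> G" if "a \<in> carrier A" for a
    using P_sub(2)[OF GP] that by (auto simp: G0_def)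
  note G_add = P_add[OF GP] and G_smult = P_smult[OF GP] and G_sv = P_sv[OF GP]
  have G_minus: "(x \<ominus>\<^bsub>B\<^esub> x', y \<ominus>\<^bsub>E\<^esub> y') \<in> G" if "(x, y) \<in> G" "(x', y') \<in> G" for x y x' y'
  proof -
    have "(\<ominus>\<^bsub>R\<^esub> \<one>\<^bsub>R\<^esub> \<odot>\<^bsub>B\<^esub> x', \<ominus>\<^bsub>R\<^esub> \<one>\<^bsub>R\<^esub> \<odot>\<^bsub>E\<^esub> y') \<in> G"
      by (rule G_smult) (use that in auto)
    then have "(\<ominus>\<^bsub>B\<^esub> x', \<ominus>\<^bsub>E\<^esub> y') \<in> G"
      using G_sub[OF that(2)] by (simp add: B.smult_l_minus E.smult_l_minus)
    from G_add[OF that(1) this] show ?thesis by (simp add: a_minus_def)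
  qed
  have G_zero: "(\<zero>\<^bsub>B\<^esub>, \<zero>\<^bsub>E\<^esub>) \<in> G"
    using G_smult[OF R.zero_closed G0_G[OF A.M.zero_closed]] i_im g_im by simp
  have total: "\<exists>y. (b, y) \<in> G" if b: "b \<in> carrier B" for b
  proof -
    define I where "I = {r \<in> carrier R. \<exists>y. (r \<odot>\<^bsub>B\<^esub> b, y) \<in> G}"
    define f where "f r = (THE y. (r \<odot>\<^bsub>B\<^esub> b, y) \<in> G)" for r
    have f_eq: "f r = y" if "(r \<odot>\<^bsub>B\<^esub> b, y) \<in> G" for r y
      unfolding f_def using that by (blast intro: the_equality G_sv)
    interpret Rm: module R "regular_module R" by (rule module_regular_module) (rule R.is_cring)
    define J where "J = (regular_module R)\<lparr>carrier := I\<rparr>"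
    have Iadd: "r \<oplus>\<^bsub>R\<^esub> s \<in> I \<and> f (r \<oplus>\<^bsub>R\<^esub> s) = f r \<oplus>\<^bsub>E\<^esub> f s" if rs: "r \<in> I" "s \<in> I" for r s
    proof -
      obtain y z where yz: "(r \<odot>\<^bsub>B\<^esub> b, y) \<in> G" "(s \<odot>\<^bsub>B\<^esub> b, z) \<in> G" "r \<in> carrier R" "s \<in> carrier R"
        using rs by (auto simp: I_def)
      from G_add[OF yz(1,2)] have "((r \<oplus>\<^bsub>R\<^esub> s) \<odot>\<^bsub>B\<^esub> b, y \<oplus>\<^bsub>E\<^esub> z) \<in> G"
        using yz b by (simp add: B.smult_l_distr)
      then show ?thesis using yz f_eq by (auto simp: I_def)
    qed
    have Ismult: "r \<otimes>\<^bsub>R\<^esub> s \<in> I \<and> f (r \<otimes>\<^bsub>R\<^esub> s) = r \<odot>\<^bsub>E\<^esub> f s" if rs: "r \<in> carrier R" "s \<in> I" for r s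
    proof -
      obtain z where z: "(s \<odot>\<^bsub>B\<^esub> b, z) \<in> G" "s \<in> carrier R"
        using rs by (auto simp: I_def)
      from G_smult[OF rs(1) z(1)] have "((r \<otimes>\<^bsub>R\<^esub> s) \<odot>\<^bsub>B\<^esub> b, r \<odot>\<^bsub>E\<^esub> z) \<in> G"
        using z b rs by (simp add: B.smult_assoc1)
      then show ?thesis using z f_eq rs by (auto simp: I_def)
    qed
    have "LinearCombinations.submodule R I (regular_module R)"
    proof (unfold_locales)
      show "I \<subseteq> carrier (regular_module R)" by (auto simp: I_def regular_module_def)
      show "\<zero>\<^bsub>regular_module R\<^esub> \<in> I"
        using G_zero b by (auto simp: I_def regular_module_def)
    qed (use Iadd Ismult in \<open>auto simp: regular_module_def\<close>)
    then have J: "module R J"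
      unfolding J_def by (rule Rm.submodule_is_module)
    have id: "(\<lambda>x. x) \<in> LinearCombinations.module_hom R J (regular_module R)"
      by (auto simp: LinearCombinations.module_hom_def J_def regular_module_def I_def)
    have "f r \<in> carrier E" if "r \<in> I" for r
      using that f_eq G_sub by (auto simp: I_def)
    then have fJ: "f \<in> LinearCombinations.module_hom R J E"
      using Iadd Ismult by (auto simp: LinearCombinations.module_hom_def J_def regular_module_def)
    obtain h where h: "h \<in> LinearCombinations.module_hom R (regular_module R) E"
      and hf: "\<And>r. r \<in> I \<Longrightarrow> h r = f r"
      using inj[unfolded injective_module_def, THEN conjunct2, rule_format, OF id fJ J
          Rm.module_axioms] by (auto simp: J_def)
    define e where "e = h \<one>\<^bsub>R\<^esub>"
    have e: "e \<in> carrier E"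
      using LinearCombinations.module_hom_closed[OF h] by (auto simp: e_def regular_module_def)
    have h_eq: "h r = r \<odot>\<^bsub>E\<^esub> e" if "r \<in> carrier R" for r
      using LinearCombinations.module_hom_smult[OF h that, of "\<one>\<^bsub>R\<^esub>"] that
      by (simp add: e_def regular_module_def)
    define G' where
      "G' = {(x \<oplus>\<^bsub>B\<^esub> r \<odot>\<^bsub>B\<^esub> b, y \<oplus>\<^bsub>E\<^esub> r \<odot>\<^bsub>E\<^esub> e) | x y r. (x, y) \<in> G \<and> r \<in> carrier R}"
    have G'I: "(u, v) \<in> G'" if "u = x \<oplus>\<^bsub>B\<^esub> r \<odot>\<^bsub>B\<^esub> b" "v = y \<oplus>\<^bsub>E\<^esub> r \<odot>\<^bsub>E\<^esub> e" "(x, y) \<in> G" "r \<in> carrier R"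
      for u v x y r
      using that by (auto simp: G'_def)
    have "G \<subseteq> G'"
    proof clarify
      fix x y assume "(x, y) \<in> G"
      then show "(x, y) \<in> G'"
        by (intro G'I[of _ x "\<zero>\<^bsub>R\<^esub>" _ y]) (use G_sub b e in auto)
    qed
    have "(b, e) \<in> G'"
      by (rule G'I[OF _ _ G_zero R.one_closed]) (use b e in auto)
    have "G' \<in> P"
    proof -
      have "G' \<subseteq> carrier B \<times> carrier E"
        using G_sub b e by (auto simp: G'_def)
      moreover have "G0 \<subseteq> G'"
        using \<open>G \<subseteq> G'\<close> P_sub(2)[OF GP] by auto
      moreover have "(u \<oplus>\<^bsub>B\<^esub> u', v \<oplus>\<^bsub>E\<^esub> v') \<in> G'" if uv: "(u, v) \<in> G'" "(u', v') \<in> G'" for u v u' v'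
      proof -
        obtain x y r where 1: "(x, y) \<in> G" "r \<in> carrier R" "u = x \<oplus>\<^bsub>B\<^esub> r \<odot>\<^bsub>B\<^esub> b" "v = y \<oplus>\<^bsub>E\<^esub> r \<odot>\<^bsub>E\<^esub> e"
          using uv(1) by (auto simp: G'_def)
        obtain x' y' r' where 2: "(x', y') \<in> G" "r' \<in> carrier R" "u' = x' \<oplus>\<^bsub>B\<^esub> r' \<odot>\<^bsub>B\<^esub> b" "v' = y' \<oplus>\<^bsub>E\<^esub> r' \<odot>\<^bsub>E\<^esub> e"
          using uv(2) by (auto simp: G'_def)
        show ?thesis
          by (rule G'I[OF _ _ G_add[OF 1(1) 2(1)] R.a_closed[OF 1(2) 2(2)]])
            (use 1 2 b e G_sub in \<open>simp_all add: B.smult_l_distr E.smult_l_distr B.M.a_ac E.M.a_ac\<close>)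
      qed
      moreover have "(s \<odot>\<^bsub>B\<^esub> u, s \<odot>\<^bsub>E\<^esub> v) \<in> G'" if uv: "s \<in> carrier R" "(u, v) \<in> G'" for s u v
      proof -
        obtain x y r where 1: "(x, y) \<in> G" "r \<in> carrier R" "u = x \<oplus>\<^bsub>B\<^esub> r \<odot>\<^bsub>B\<^esub> b" "v = y \<oplus>\<^bsub>E\<^esub> r \<odot>\<^bsub>E\<^esub> e"
          using uv(2) by (auto simp: G'_def)
        show ?thesis
          by (rule G'I[OF _ _ G_smult[OF uv(1) 1(1)] R.m_closed[OF uv(1) 1(2)]])
            (use 1 uv(1) b e G_sub in \<open>simp_all add: B.smult_r_distr E.smult_r_distr B.smult_assoc1 E.smult_assoc1\<close>)
      qed
      moreover have "v = v'" if uv: "(u, v) \<in> G'" "(u, v') \<in> G'" for u v v'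
      proof -
        obtain x y r where 1: "(x, y) \<in> G" "r \<in> carrier R" "u = x \<oplus>\<^bsub>B\<^esub> r \<odot>\<^bsub>B\<^esub> b" "v = y \<oplus>\<^bsub>E\<^esub> r \<odot>\<^bsub>E\<^esub> e"
          using uv(1) by (auto simp: G'_def)
        obtain x' y' r' where 2: "(x', y') \<in> G" "r' \<in> carrier R" "u = x' \<oplus>\<^bsub>B\<^esub> r' \<odot>\<^bsub>B\<^esub> b" "v' = y' \<oplus>\<^bsub>E\<^esub> r' \<odot>\<^bsub>E\<^esub> e"
          using uv(2) by (auto simp: G'_def)
        define s where "s = r' \<ominus>\<^bsub>R\<^esub> r"
        have s: "s \<in> carrier R" "r' = s \<oplus>\<^bsub>R\<^esub> r"
          using 1 2 by (auto simp: s_def a_minus_def R.a_assoc R.l_neg)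
        note c = 1(2) 2(2) G_sub[OF 1(1)] G_sub[OF 2(1)] b e s(1)
        have "x \<oplus>\<^bsub>B\<^esub> r \<odot>\<^bsub>B\<^esub> b = (x' \<oplus>\<^bsub>B\<^esub> s \<odot>\<^bsub>B\<^esub> b) \<oplus>\<^bsub>B\<^esub> r \<odot>\<^bsub>B\<^esub> b"
          using 1(3) 2(3) c by (simp add: s(2) B.smult_l_distr B.M.a_assoc)
        then have "x = x' \<oplus>\<^bsub>B\<^esub> s \<odot>\<^bsub>B\<^esub> b"
          using c by simp
        then have "x \<ominus>\<^bsub>B\<^esub> x' = s \<odot>\<^bsub>B\<^esub> b"
          using c by (simp add: a_minus_def B.M.a_ac B.M.r_neg1 B.M.r_neg B.M.r_neg2)
        then have sG: "(s \<odot>\<^bsub>B\<^esub> b, y \<ominus>\<^bsub>E\<^esub> y') \<in> G"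
          using G_minus[OF 1(1) 2(1)] by simp
        then have "s \<in> I" using s by (auto simp: I_def)
        then have "s \<odot>\<^bsub>E\<^esub> e = y \<ominus>\<^bsub>E\<^esub> y'"
          using hf[of s] f_eq[OF sG] h_eq[of s] s(1) by metis
        then have "y' \<oplus>\<^bsub>E\<^esub> s \<odot>\<^bsub>E\<^esub> e = y"
          using c by (simp add: a_minus_def E.M.a_lcomm[of y' y] E.M.r_neg)
        then show ?thesis
          using c 1(4) 2(4) by (simp add: s(2) E.smult_l_distr flip: E.M.a_assoc)
      qed
      ultimately show ?thesis by (intro P_I)
    qed
    with G_max \<open>G \<subseteq> G'\<close> \<open>(b, e) \<in> G'\<close> show ?thesis by blast
  qed
  define h where "h b = (THE y. (b, y) \<in> G)" for b
  have h_eq: "h b = y" if "(b, y) \<in> G" for b y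
    unfolding h_def using that by (blast intro: the_equality G_sv)
  have hG: "(b, h b) \<in> G" if "b \<in> carrier B" for b
    using total[OF that] h_eq by auto
  have "h \<in> LinearCombinations.module_hom R B E"
    unfolding LinearCombinations.module_hom_def
    using hG G_sub(2)[OF hG] by (auto intro!: h_eq G_add G_smult)
  moreover have "\<forall>x \<in> carrier A. h (i x) = g x"
    using h_eq G0_G by auto
  ultimately show ?thesis by blast
qed

end

theory Submission
  imports Defs
begin

text \<open>
  The envelope \<open>E\<close> is the dual \<open>D = Hom\<^sub>k(R, k)\<close>: identify the socles, extend to a map \<open>h : D \<rightarrow> E\<close> by
  injectivity of \<open>E\<close>, and show by induction on \<open>j\<close> that the elements of \<open>E\<close> killed by \<open>\<nn>\<^sup>j\<close> lie in the
  image, since essentiality makes the socle of \<open>E\<close> one-dimensional. So \<open>E\<close> is spanned by elements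
  \<open>y\<^sub>a\<close> with \<open>|a| < n\<close> such that \<open>x\<^sup>b y\<^sub>a = y\<^sub>a\<^sub>-\<^sub>b\<close> if \<open>b \<le> a\<close>, and \<open>0\<close> otherwise.

  For a homomorphism \<open>\<phi> : E \<rightarrow> R\<close> and \<open>|a| = n - 1\<close>, the relations \<open>x\<^sub>i y\<^sub>a = x\<^sub>j y\<^sub>b\<close> with
  \<open>a - e\<^sub>i = b - e\<^sub>j\<close>, together with \<open>x\<^sub>i y\<^sub>a = 0\<close> for \<open>a\<^sub>i = 0\<close>, force \<open>\<phi>(y\<^sub>a)\<close> into the socle \<open>\<mm>\<^sup>n\<^sup>-\<^sup>1\<close>; here at
  least two variables are needed. Hence \<open>\<mm>E\<^sup>* = 0\<close>, and \<open>E\<^sup>* = Hom\<^sub>k(E/\<mm>E, \<mm>\<^sup>n\<^sup>-\<^sup>1)\<close> has a basis indexed by pairs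
  of monomials of degree \<open>n - 1\<close>.
\<close>

declare One_nat_def [simp del]

section \<open>Exponents and multivariate polynomials\<close>

definition exp_degree :: "('v::finite \<Rightarrow>\<^sub>0 nat) \<Rightarrow> nat" where
  "exp_degree a = (\<Sum>v\<in>UNIV. Poly_Mapping.lookup a v)"

lemma exp_degree_zero [simp]: "exp_degree 0 = 0"
  by (simp add: exp_degree_def)

lemma exp_degree_add [simp]: "exp_degree (a + b) = exp_degree a + exp_degree b"
  by (simp add: exp_degree_def lookup_add sum.distrib)

lemma exp_degree_single [simp]: "exp_degree (Poly_Mapping.single v m) = m"
  by (simp add: exp_degree_def lookup_single when_def)

lemma exp_degree_eq_0_iff [simp]: "exp_degree a = 0 \<longleftrightarrow> a = 0"
  by (auto simp: exp_degree_def intro: poly_mapping_eqI)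

lemma single_add_diff_cancel:
  assumes "Poly_Mapping.lookup a v \<ge> m"
  shows "Poly_Mapping.single v m + (a - Poly_Mapping.single v m) = (a :: 'v \<Rightarrow>\<^sub>0 nat)"
  using assms by (intro poly_mapping_eqI) (auto simp: lookup_add lookup_minus lookup_single when_def)

text \<open>An exponent vector in finitely many variables is the multiplicity function of a multiset
  of variables, with the degree as its size. This reduces counting monomials to the known count of
  multisets.\<close>

lemma bij_betw_exp_degree_multisets:
  "bij_betw (\<lambda>a. Abs_multiset (Poly_Mapping.lookup a)) {a :: 'v::finite \<Rightarrow>\<^sub>0 nat. exp_degree a = d}
     (multisets_of_size UNIV d)"
proof (rule bij_betwI[where g = "\<lambda>M. Abs_poly_mapping (count M)"])
  show "(\<lambda>a. Abs_multiset (Poly_Mapping.lookup a)) \<in>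
      {a :: 'v \<Rightarrow>\<^sub>0 nat. exp_degree a = d} \<rightarrow> multisets_of_size UNIV d"
    by (auto simp: multisets_of_size_def exp_degree_def size_multiset_overloaded_eq
        count_Abs_multiset intro!: sum.mono_neutral_left simp flip: count_greater_zero_iff)
  show "(\<lambda>M. Abs_poly_mapping (count M)) \<in>
      multisets_of_size UNIV d \<rightarrow> {a :: 'v \<Rightarrow>\<^sub>0 nat. exp_degree a = d}"
    by (auto simp: multisets_of_size_def exp_degree_def size_multiset_overloaded_eq
         intro!: sum.mono_neutral_right simp: not_in_iff)
qed (simp_all add: count_Abs_multiset)

lemma finite_exp_degree_eq: "finite {a :: 'v::finite \<Rightarrow>\<^sub>0 nat. exp_degree a = d}"
  using bij_betw_finite[OF bij_betw_exp_degree_multisets[where 'v = 'v, of d]]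
  by (simp add: finite_multisets_of_size)

lemma card_exp_degree_eq:
  "card {a :: 'v::finite \<Rightarrow>\<^sub>0 nat. exp_degree a = d} = (CARD('v) + d - 1) choose d"
  using bij_betw_same_card[OF bij_betw_exp_degree_multisets[where 'v = 'v, of d]]
  by (simp add: card_multisets_of_size)

lemma finite_exp_degree_less: "finite {a :: 'v::finite \<Rightarrow>\<^sub>0 nat. exp_degree a < d}"
proof -
  have "{a :: 'v \<Rightarrow>\<^sub>0 nat. exp_degree a < d} = (\<Union>j<d. {a. exp_degree a = j})"
    by auto
  then show ?thesis by (simp add: finite_exp_degree_eq)
qed

section \<open>Coefficients of products\<close>

lemma lookup_single_mult_add [simp]:
  fixes q :: "('a :: cancel_comm_monoid_add) \<Rightarrow>\<^sub>0 ('b :: semiring_0)"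
  shows "Poly_Mapping.lookup (Poly_Mapping.single a c * q) (a + d) = c * Poly_Mapping.lookup q d"
proof -
  have "Poly_Mapping.lookup (Poly_Mapping.single a c * q) (a + d) =
      Sum_any (\<lambda>l. (c * Sum_any (\<lambda>r. Poly_Mapping.lookup q r when a + d = l + r)) when a = l)"
    unfolding lookup_mult by (intro Sum_any.cong) (simp add: lookup_single when_def)
  then show ?thesis by simp
qed

lemma lookup_single_0_mult [simp]:
  fixes q :: "('a :: cancel_comm_monoid_add) \<Rightarrow>\<^sub>0 ('b :: semiring_0)"
  shows "Poly_Mapping.lookup (Poly_Mapping.single 0 c * q) d = c * Poly_Mapping.lookup q d"
  using lookup_single_mult_add[of 0 c q d] by simp

lemma lookup_single_mult_eq_0:
  assumes "\<And>d'. d \<noteq> a + d'"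
  shows "Poly_Mapping.lookup (Poly_Mapping.single a c * q) d = 0"
proof -
  have "Poly_Mapping.lookup (Poly_Mapping.single a c * q) d = Sum_any (\<lambda>l. (0 when a = l))"
    unfolding lookup_mult using assms
    by (intro Sum_any.cong) (auto simp: lookup_single when_def)
  then show ?thesis by simp
qed

text \<open>Natural exponents add up to 0 only if both are 0, so a single term of the convolution
  survives.\<close>

lemma lookup_mult_0 [simp]:
  fixes p q :: "('v::finite, 'k::field) mpoly"
  shows "Poly_Mapping.lookup (p * q) 0 = Poly_Mapping.lookup p 0 * Poly_Mapping.lookup q 0"
proof -
  have 0: "0 = l + r \<longleftrightarrow> l = 0 \<and> r = 0" for l r :: "'v \<Rightarrow>\<^sub>0 nat"
    by (metis add_0 add_is_0 exp_degree_add exp_degree_eq_0_iff)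
  have 1: "Sum_any (\<lambda>r. Poly_Mapping.lookup q r when 0 = l + r) = (Poly_Mapping.lookup q 0 when l = 0)"
    for l
  proof (cases "l = 0")
    case False
    then have "(\<lambda>r. Poly_Mapping.lookup q r when 0 = l + r) = (\<lambda>r. 0)"
      using 0 by (intro ext) (simp only: when_def simp_thms if_False)
    then have "Sum_any (\<lambda>r. Poly_Mapping.lookup q r when 0 = l + r) = Sum_any (\<lambda>r :: 'v \<Rightarrow>\<^sub>0 nat. 0)"
      by (rule arg_cong)
    with False show ?thesis by simp
  qed simp
  have "Poly_Mapping.lookup (p * q) 0 =
      Sum_any (\<lambda>l. Poly_Mapping.lookup p l * Poly_Mapping.lookup q 0 when l = 0)"
    unfolding lookup_mult 1 by (intro Sum_any.cong) (simp only: mult_when)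
  then show ?thesis by simp
qed

lemma mpoly_sum_monomials:
  fixes p :: "'a \<Rightarrow>\<^sub>0 'b::comm_monoid_add"
  shows "p = (\<Sum>a\<in>Poly_Mapping.keys p. Poly_Mapping.single a (Poly_Mapping.lookup p a))"
  by (intro poly_mapping_eqI) (auto simp: lookup_sum lookup_single when_def in_keys_iff)

section \<open>Powers of the ideal of the variables, described by order of vanishing\<close>

definition order_ideal :: "nat \<Rightarrow> ('v::finite, 'k::field) mpoly set" where
  "order_ideal j = {p. \<forall>a. exp_degree a < j \<longrightarrow> Poly_Mapping.lookup p a = 0}"

lemma order_idealI: "(\<And>a. exp_degree a < j \<Longrightarrow> Poly_Mapping.lookup p a = 0) \<Longrightarrow> p \<in> order_ideal j"
  by (simp add: order_ideal_def)

lemma order_idealD: "p \<in> order_ideal j \<Longrightarrow> exp_degree a < j \<Longrightarrow> Poly_Mapping.lookup p a = 0"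
  by (simp add: order_ideal_def)

lemma order_ideal_mono: "p \<in> order_ideal i \<Longrightarrow> j \<le> i \<Longrightarrow> p \<in> order_ideal j"
  by (simp add: order_ideal_def)

lemma order_ideal_0 [simp]: "order_ideal 0 = UNIV"
  by (auto simp: order_ideal_def)

lemma zero_in_order_ideal [simp]: "0 \<in> order_ideal j"
  by (simp add: order_ideal_def)

lemma add_in_order_ideal: "p \<in> order_ideal j \<Longrightarrow> q \<in> order_ideal j \<Longrightarrow> p + q \<in> order_ideal j"
  by (simp add: order_ideal_def lookup_add)

lemma uminus_in_order_ideal: "p \<in> order_ideal j \<Longrightarrow> - p \<in> order_ideal j"
  by (simp add: order_ideal_def)

text \<open>Every exponent in the support of \<open>p * q\<close> is a sum of exponents from the two
  supports, and degrees add.\<close>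

lemma mult_in_order_ideal:
  fixes p q :: "('v::finite, 'k::field) mpoly"
  assumes "p \<in> order_ideal i" "q \<in> order_ideal j"
  shows "p * q \<in> order_ideal (i + j)"
proof (rule order_idealI, rule ccontr)
  fix a :: "'v \<Rightarrow>\<^sub>0 nat"
  assume a: "exp_degree a < i + j" "Poly_Mapping.lookup (p * q) a \<noteq> 0"
  then have "a \<in> Poly_Mapping.keys (p * q)" by (simp add: in_keys_iff)
  then obtain b c where bc: "a = b + c" "b \<in> Poly_Mapping.keys p" "c \<in> Poly_Mapping.keys q"
    using keys_mult[of p q] by blast
  then have "exp_degree b \<ge> i" "exp_degree c \<ge> j"
    using assms by (auto simp: in_keys_iff dest: order_idealD simp flip: not_less)
  with a(1) bc(1) show False by simp
qed

lemma single_in_order_ideal: "j \<le> exp_degree a \<Longrightarrow> Poly_Mapping.single a c \<in> order_ideal j"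
  by (auto simp: order_ideal_def lookup_single when_def)

lemma mpoly_ring_simps [simp]:
  "carrier mpoly_ring = UNIV" "x \<otimes>\<^bsub>mpoly_ring\<^esub> y = x * y" "x \<oplus>\<^bsub>mpoly_ring\<^esub> y = x + y"
  "\<one>\<^bsub>mpoly_ring\<^esub> = 1" "\<zero>\<^bsub>mpoly_ring\<^esub> = 0"
  by (simp_all add: mpoly_ring_def)

lemma cring_mpoly_ring: "cring (mpoly_ring :: ('v::finite, 'k::field) mpoly ring)"
  unfolding mpoly_ring_def by (rule class_cring.is_cring)

lemma ideal_order_ideal: "ideal (order_ideal j) (mpoly_ring :: ('v::finite, 'k::field) mpoly ring)"
proof (rule idealI)
  show "ring (mpoly_ring :: ('v, 'k) mpoly ring)"
    using cring_mpoly_ring by (rule cring.axioms)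
  then interpret ring "mpoly_ring :: ('v, 'k) mpoly ring" .
  have "inv\<^bsub>add_monoid mpoly_ring\<^esub> p = - p" for p :: "('v, 'k) mpoly"
    by (subst a_inv_def[symmetric]) (simp add: mpoly_ring_def class_ring_simps)
  then show "subgroup (order_ideal j) (add_monoid (mpoly_ring :: ('v, 'k) mpoly ring))"
    by (intro subgroup.intro) (auto intro: add_in_order_ideal uminus_in_order_ideal)
next
  fix p q :: "('v, 'k) mpoly" assume "p \<in> order_ideal j"
  then show "q \<otimes>\<^bsub>mpoly_ring\<^esub> p \<in> order_ideal j" "p \<otimes>\<^bsub>mpoly_ring\<^esub> q \<in> order_ideal j"
    using mult_in_order_ideal[of q 0 p j] mult_in_order_ideal[of p j q 0] by simp_all
qed

text \<open>A polynomial is the finite sum of its terms, and membership in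
  \<open>order_ideal j\<close> forces each of them to have degree at least \<open>j\<close>.\<close>

lemma order_ideal_induct [consumes 1, case_names zero add monomial]:
  fixes p :: "('v::finite, 'k::field) mpoly"
  assumes "p \<in> order_ideal j" and "P 0" and "\<And>p q. P p \<Longrightarrow> P q \<Longrightarrow> P (p + q)"
    and monom: "\<And>a c. exp_degree a \<ge> j \<Longrightarrow> P (Poly_Mapping.single a c)"
  shows "P p"
proof -
  have "P (\<Sum>a\<in>A. Poly_Mapping.single a (Poly_Mapping.lookup p a))"
    if "finite A" "A \<subseteq> Poly_Mapping.keys p" for A
    using that
  proof (induction A rule: finite_induct)
    case (insert a A)
    then have "exp_degree a \<ge> j"
      using assms(1) by (auto simp: in_keys_iff dest: order_idealD simp flip: not_less)
    with insert assms(3) monom show ?case by simp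
  qed (use assms in simp)
  from this[OF finite_keys order_refl] show ?thesis
    using mpoly_sum_monomials[of p] by simp
qed

text \<open>A monomial of positive degree has a variable that can be split off. This form of
  induction matches the generators of the product of \<open>order_ideal j\<close> with the ideal of
  the variables.\<close>

lemma order_ideal_Suc_induct [consumes 1, case_names zero add monomial]:
  fixes p :: "('v::finite, 'k::field) mpoly"
  assumes "p \<in> order_ideal (Suc j)" and "P 0" and "\<And>p q. P p \<Longrightarrow> P q \<Longrightarrow> P (p + q)"
    and monom: "\<And>v a c. exp_degree a \<ge> j \<Longrightarrow> P (mpoly_var v * Poly_Mapping.single a c)"
  shows "P p"
  using assms(1)
proof (induction rule: order_ideal_induct)
  case (monomial a c)
  then have "a \<noteq> 0" by auto
  then obtain v where "Poly_Mapping.lookup a v > 0"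
    using poly_mapping_eqI[of a 0] by force
  then have 1: "Poly_Mapping.single v 1 + (a - Poly_Mapping.single v 1) = a"
    by (intro single_add_diff_cancel) simp
  have "exp_degree (Poly_Mapping.single v 1 + (a - Poly_Mapping.single v 1)) \<ge> Suc j"
    using monomial 1 by simp
  then have "P (mpoly_var v * Poly_Mapping.single (a - Poly_Mapping.single v 1) c)"
    by (intro monom) simp
  then show ?case
    using 1 by (simp add: mpoly_var_def mult_single)
qed (use assms in auto)

lemma mpoly_var_in_order_ideal: "mpoly_var v \<in> order_ideal 1"
  by (simp add: mpoly_var_def single_in_order_ideal)

lemma genideal_mpoly_var:
  "genideal (mpoly_ring :: ('v::finite, 'k::field) mpoly ring) (range mpoly_var) = order_ideal 1"
proof
  interpret cring "mpoly_ring :: ('v, 'k) mpoly ring" by (rule cring_mpoly_ring)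
  show "genideal (mpoly_ring :: ('v, 'k) mpoly ring) (range mpoly_var) \<subseteq> order_ideal 1"
    by (intro genideal_minimal ideal_order_ideal) (use mpoly_var_in_order_ideal in auto)
  interpret G: ideal "genideal mpoly_ring (range mpoly_var)" "mpoly_ring :: ('v, 'k) mpoly ring"
    by (rule genideal_ideal) simp
  show "order_ideal 1 \<subseteq> genideal (mpoly_ring :: ('v, 'k) mpoly ring) (range mpoly_var)"
  proof
    fix p :: "('v, 'k) mpoly" assume "p \<in> order_ideal 1"
    then have "p \<in> order_ideal (Suc 0)" by (simp add: One_nat_def)
    then show "p \<in> genideal mpoly_ring (range mpoly_var)"
    proof (induction rule: order_ideal_Suc_induct)
      case (monomial v a c)
      have "mpoly_var v \<in> genideal mpoly_ring (range (mpoly_var :: 'v \<Rightarrow> ('v, 'k) mpoly))"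
        using genideal_self[of "range mpoly_var"] by auto
      from G.I_r_closed[OF this, of "Poly_Mapping.single a c"] show ?case by simp
    qed (use G.a_closed G.zero_closed in auto)
  qed
qed

text \<open>In the inductive step one inclusion holds because orders add under multiplication, the
  other because a variable splits off every term of degree at least \<open>Suc j\<close>. Together
  with \<open>genideal_mpoly_var\<close> this allows ideal powers to be replaced by conditions on
  coefficients.\<close>

lemma order_ideal_1_pow:
  "order_ideal 1 [^]\<^bsub>ideals_set mpoly_ring\<^esub> j = (order_ideal j :: ('v::finite, 'k::field) mpoly set)"
proof (induction j)
  case 0
  then show ?case by (simp add: ideals_set_def nat_pow_def)
next
  case (Suc j)
  have "ideal_prod mpoly_ring (order_ideal j) (order_ideal 1) = (order_ideal (Suc j) :: ('v, 'k) mpoly set)"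
  proof
    show "ideal_prod mpoly_ring (order_ideal j) (order_ideal 1) \<subseteq> (order_ideal (Suc j) :: ('v, 'k) mpoly set)"
    proof
      fix p :: "('v, 'k) mpoly"
      assume "p \<in> ideal_prod mpoly_ring (order_ideal j) (order_ideal 1)"
      then show "p \<in> order_ideal (Suc j)"
        by induction (use mult_in_order_ideal[where i = j and j = 1] add_in_order_ideal in \<open>auto simp: One_nat_def\<close>)
    qed
    show "(order_ideal (Suc j) :: ('v, 'k) mpoly set) \<subseteq> ideal_prod mpoly_ring (order_ideal j) (order_ideal 1)"
    proof
      fix p :: "('v, 'k) mpoly"
      assume "p \<in> order_ideal (Suc j)"
      then show "p \<in> ideal_prod mpoly_ring (order_ideal j) (order_ideal 1)"
      proof (induction rule: order_ideal_Suc_induct)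
        case zero
        show ?case
          using ideal_prod.prod[of 0 "order_ideal j" 0 "order_ideal 1" mpoly_ring] by simp
      next
        case (add p q)
        then show ?case using ideal_prod.sum by fastforce
      next
        case (monomial v a c)
        then show ?case
          using ideal_prod.prod[of "Poly_Mapping.single a c" "order_ideal j" "mpoly_var v" "order_ideal 1" mpoly_ring]
          by (simp add: single_in_order_ideal mpoly_var_in_order_ideal mult.commute)
      qed
    qed
  qed
  with Suc show ?case by (simp add: ideals_set_def nat_pow_def)
qed

section \<open>Truncated polynomial rings and their modules\<close>

definition trunc_ring :: "nat \<Rightarrow> ('v::finite, 'k::field) mpoly set ring" where
  "trunc_ring n = mpoly_ring Quot order_ideal n"

definition trunc :: "nat \<Rightarrow> ('v::finite, 'k::field) mpoly \<Rightarrow> ('v, 'k) mpoly set" where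
  "trunc n p = order_ideal n +>\<^bsub>mpoly_ring\<^esub> p"

lemma cring_trunc_ring: "cring (trunc_ring n :: ('v::finite, 'k::field) mpoly set ring)"
  unfolding trunc_ring_def by (rule ideal.quotient_is_cring[OF ideal_order_ideal cring_mpoly_ring])

lemma trunc_ring_hom: "ring_hom_ring mpoly_ring (trunc_ring n) (trunc n :: ('v::finite, 'k::field) mpoly \<Rightarrow> _)"
  using ideal.rcos_ring_hom_ring[OF ideal_order_ideal[of n, where 'v = 'v and 'k = 'k]]
  by (simp add: trunc_ring_def trunc_def[abs_def])

lemma trunc_eq_iff:
  fixes p q :: "('v::finite, 'k::field) mpoly"
  shows "trunc n p = trunc n q \<longleftrightarrow> (\<forall>a. exp_degree a < n \<longrightarrow> Poly_Mapping.lookup p a = Poly_Mapping.lookup q a)"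
proof -
  interpret I: ideal "order_ideal n" "mpoly_ring :: ('v, 'k) mpoly ring" by (rule ideal_order_ideal)
  have "p \<ominus>\<^bsub>mpoly_ring\<^esub> q = p - q" by (simp add: mpoly_ring_def class_ring_simps)
  then have "trunc n p = trunc n q \<longleftrightarrow> p - q \<in> order_ideal n"
    using I.quotient_eq_iff_same_a_r_cos[OF ideal_order_ideal[of n], of p q] by (simp add: trunc_def)
  then show ?thesis by (simp add: order_ideal_def lookup_minus)
qed

lemma carrier_trunc_ring: "carrier (trunc_ring n) = range (trunc n)"
  by (auto simp: trunc_ring_def trunc_def FactRing_def A_RCOSETS_def' a_r_coset_def RCOSETS_def)

lemma trunc_in_carrier [simp]: "trunc n p \<in> carrier (trunc_ring n)"
  by (simp add: carrier_trunc_ring)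

lemma trunc_simps [simp]:
  "trunc n p \<oplus>\<^bsub>trunc_ring n\<^esub> trunc n q = trunc n (p + q)"
  "trunc n p \<otimes>\<^bsub>trunc_ring n\<^esub> trunc n q = trunc n (p * q)"
proof -
  interpret ring_hom_ring mpoly_ring "trunc_ring n" "trunc n" by (rule trunc_ring_hom)
  show "trunc n p \<oplus>\<^bsub>trunc_ring n\<^esub> trunc n q = trunc n (p + q)"
    "trunc n p \<otimes>\<^bsub>trunc_ring n\<^esub> trunc n q = trunc n (p * q)"
    using hom_add[of p q] hom_mult[of p q] by simp_all
qed

lemma trunc_ring_zero: "\<zero>\<^bsub>trunc_ring n\<^esub> = (trunc n 0 :: ('v::finite, 'k::field) mpoly set)"
proof -
  interpret ring_hom_ring mpoly_ring "trunc_ring n" "trunc n :: ('v, 'k) mpoly \<Rightarrow> _" by (rule trunc_ring_hom)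
  show ?thesis using hom_zero by simp
qed

lemma trunc_ring_one: "\<one>\<^bsub>trunc_ring n\<^esub> = (trunc n 1 :: ('v::finite, 'k::field) mpoly set)"
proof -
  interpret ring_hom_ring mpoly_ring "trunc_ring n" "trunc n :: ('v, 'k) mpoly \<Rightarrow> _" by (rule trunc_ring_hom)
  show ?thesis using hom_one by simp
qed

lemma trunc_eq_0_iff: "trunc n p = trunc n 0 \<longleftrightarrow> p \<in> order_ideal n"
  by (simp add: trunc_eq_iff order_ideal_def)

text \<open>Meaningful only for exponents of degree less than \<open>n\<close>, where it does not depend on the chosen
  representative.\<close>

definition trunc_coeff :: "nat \<Rightarrow> ('v::finite, 'k::field) mpoly set \<Rightarrow> ('v \<Rightarrow>\<^sub>0 nat) \<Rightarrow> 'k" where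
  "trunc_coeff n r a = Poly_Mapping.lookup (SOME p. r = trunc n p) a"

lemma trunc_coeff_trunc [simp]:
  assumes "exp_degree a < n"
  shows "trunc_coeff n (trunc n p) a = Poly_Mapping.lookup p a"
proof -
  have "trunc n p = trunc n (SOME q. trunc n p = trunc n q)"
    by (rule someI_ex) blast
  with assms show ?thesis by (simp add: trunc_coeff_def trunc_eq_iff)
qed

lemma trunc_ring_eqI:
  assumes "r \<in> carrier (trunc_ring n)" "s \<in> carrier (trunc_ring n)"
    and "\<And>a. exp_degree a < n \<Longrightarrow> trunc_coeff n r a = trunc_coeff n s a"
  shows "r = s"
proof -
  obtain p q where "r = trunc n p" "s = trunc n q"
    using assms(1,2) by (auto simp: carrier_trunc_ring)
  with assms(3) show ?thesis by (simp add: trunc_eq_iff)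
qed

section \<open>Polynomials acting on modules over the truncated ring\<close>

locale trunc_module =
  fixes n :: nat and M :: "(('v::finite, 'k::field) mpoly set, 'b) module"
  assumes module: "Module.module (trunc_ring n) M"
begin

sublocale Mod: Module.module "trunc_ring n" M by (rule module)

abbreviation act :: "('v, 'k) mpoly \<Rightarrow> 'b \<Rightarrow> 'b" where
  "act p z \<equiv> trunc n p \<odot>\<^bsub>M\<^esub> z"

lemma act_add: "z \<in> carrier M \<Longrightarrow> act (p + q) z = act p z \<oplus>\<^bsub>M\<^esub> act q z"
  using Mod.smult_l_distr[of "trunc n p" "trunc n q" z] by simp

lemma act_mult: "z \<in> carrier M \<Longrightarrow> act (p * q) z = act p (act q z)"
  using Mod.smult_assoc1[of "trunc n p" "trunc n q" z] by simp

lemma act_zero [simp]: "z \<in> carrier M \<Longrightarrow> act 0 z = \<zero>\<^bsub>M\<^esub>"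
  using Mod.smult_l_null[of z] by (simp add: trunc_ring_zero)

lemma act_one [simp]: "z \<in> carrier M \<Longrightarrow> act 1 z = z"
  using Mod.smult_one[of z] by (simp add: trunc_ring_one)

lemma act_order_ideal:
  assumes "p \<in> order_ideal n" "z \<in> carrier M"
  shows "act p z = \<zero>\<^bsub>M\<^esub>"
  using assms trunc_eq_0_iff[of n p] act_zero[of z] by simp

lemma act_const_inverse:
  assumes "z \<in> carrier M" "c \<noteq> 0"
  shows "act (mpoly_const (inverse c)) (act (mpoly_const c) z) = z"
  using assms act_mult[of z "mpoly_const (inverse c)" "mpoly_const c"]
  by (simp add: mpoly_const_def mult_single)

text \<open>The difference of \<open>p\<close> and its constant term has order at least 1, so it
  annihilates \<open>z\<close>.\<close>

lemma act_const_term: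
  assumes "z \<in> carrier M" and "\<And>q. q \<in> order_ideal 1 \<Longrightarrow> act q z = \<zero>\<^bsub>M\<^esub>"
  shows "act p z = act (mpoly_const (Poly_Mapping.lookup p 0)) z"
proof -
  let ?c = "mpoly_const (Poly_Mapping.lookup p 0)"
  have "p - ?c \<in> order_ideal 1"
    by (simp add: order_ideal_def mpoly_const_def lookup_minus)
  with assms have "act (p - ?c + ?c) z = act ?c z"
    by (subst act_add) auto
  then show ?thesis by simp
qed

end

text \<open>All that the later argument needs from an injective envelope of the residue field:
  injectivity, and a socle that is a line spanned by \<open>y0\<close>. Essentiality enters only
  through the last assumption.\<close>

locale trunc_envelope = trunc_module n M
  for n :: nat and M :: "(('v::finite, 'k::field) mpoly set, 'b) module" +
  fixes y0
  assumes injective: "injective_module (trunc_ring n) M"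
    and y0: "y0 \<in> carrier M" "y0 \<noteq> \<zero>\<^bsub>M\<^esub>"
    and order_ideal_y0: "p \<in> order_ideal 1 \<Longrightarrow> act p y0 = \<zero>\<^bsub>M\<^esub>"
    and socle: "z \<in> carrier M \<Longrightarrow> (\<And>p. p \<in> order_ideal 1 \<Longrightarrow> act p z = \<zero>\<^bsub>M\<^esub>) \<Longrightarrow>
      \<exists>c. z = act (mpoly_const c) y0"

lemma ideal_trunc_order_ideal:
  "ideal (trunc n ` order_ideal 1) (trunc_ring n :: ('v::finite, 'k::field) mpoly set ring)"
proof (rule idealI)
  interpret cring "trunc_ring n :: ('v, 'k) mpoly set ring" by (rule cring_trunc_ring)
  show "ring (trunc_ring n :: ('v, 'k) mpoly set ring)" by (rule ring_axioms)
  have minus: "\<ominus>\<^bsub>trunc_ring n\<^esub> trunc n p = trunc n (- p)" for p :: "('v, 'k) mpoly"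
    by (rule minus_equality) (simp_all add: trunc_ring_zero)
  show "subgroup (trunc n ` order_ideal 1) (add_monoid (trunc_ring n :: ('v, 'k) mpoly set ring))"
  proof (intro subgroup.intro)
    fix x :: "('v, 'k) mpoly set" assume "x \<in> trunc n ` order_ideal 1"
    then show "inv\<^bsub>add_monoid (trunc_ring n)\<^esub> x \<in> trunc n ` order_ideal 1"
      by (subst a_inv_def[symmetric]) (auto simp: minus intro: uminus_in_order_ideal)
  qed (auto simp: trunc_ring_zero intro: add_in_order_ideal)
next
  fix r x :: "('v, 'k) mpoly set" assume r: "r \<in> trunc n ` order_ideal 1" "x \<in> carrier (trunc_ring n)"
  then obtain p q where "r = trunc n p" "p \<in> order_ideal 1" "x = trunc n q"
    by (auto simp: carrier_trunc_ring)
  then show "x \<otimes>\<^bsub>trunc_ring n\<^esub> r \<in> trunc n ` order_ideal 1" "r \<otimes>\<^bsub>trunc_ring n\<^esub> x \<in> trunc n ` order_ideal 1"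
    using mult_in_order_ideal[of q 0 p 1] mult_in_order_ideal[of p 1 q 0] by simp_all
qed

text \<open>The class of 1 serves as \<open>u\<close>. This records the residue field as a nonzero
  cyclic module killed by the maximal ideal, so that cosets of cosets need not be handled
  again.\<close>

lemma residue_module_generator:
  assumes n: "n \<ge> 1"
  defines "K \<equiv> residue_module (trunc_ring n :: ('v::finite, 'k::field) mpoly set ring) (trunc n ` order_ideal 1)"
  shows "\<exists>u\<in>carrier K. u \<noteq> \<zero>\<^bsub>K\<^esub> \<and> carrier K = range (\<lambda>p. trunc n p \<odot>\<^bsub>K\<^esub> u) \<and>
    (\<forall>p\<in>order_ideal 1. trunc n p \<odot>\<^bsub>K\<^esub> u = \<zero>\<^bsub>K\<^esub>)"
proof -
  let ?R = "trunc_ring n :: ('v, 'k) mpoly set ring"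
  define m where "m = (trunc n ` order_ideal 1 :: ('v, 'k) mpoly set set)"
  define u where "u = m +>\<^bsub>?R\<^esub> trunc n 1"
  interpret m: ideal m ?R unfolding m_def by (rule ideal_trunc_order_ideal)
  have act_u: "trunc n p \<odot>\<^bsub>K\<^esub> u = m +>\<^bsub>?R\<^esub> trunc n p" for p
    using ring_hom_mult[OF m.rcos_ring_hom, of "trunc n p" "trunc n 1"]
    by (simp add: K_def residue_module_def u_def flip: m_def)
  have zero_K: "\<zero>\<^bsub>K\<^esub> = m"
    by (simp add: K_def residue_module_def FactRing_def flip: m_def)
  have cK: "carrier K = range (\<lambda>p. trunc n p \<odot>\<^bsub>K\<^esub> u)"
    unfolding act_u unfolding K_def m_def[symmetric]
    by (auto simp: residue_module_def FactRing_def A_RCOSETS_def' a_r_coset_def RCOSETS_def carrier_trunc_ring)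
  have "u \<in> carrier K"
    using cK act_u[of 1] by (auto simp: u_def)
  moreover have "trunc n p \<odot>\<^bsub>K\<^esub> u = \<zero>\<^bsub>K\<^esub>" if "p \<in> order_ideal 1" for p
    unfolding act_u zero_K by (rule m.a_rcos_const) (use that in \<open>simp add: m_def\<close>)
  moreover have "u \<noteq> \<zero>\<^bsub>K\<^esub>"
  proof
    assume "u = \<zero>\<^bsub>K\<^esub>"
    then have "trunc n 1 \<in> m"
      using m.a_rcos_self[of "trunc n 1"] by (simp add: zero_K u_def)
    then obtain p :: "('v, 'k) mpoly" where "p \<in> order_ideal 1" "trunc n 1 = trunc n p"
      by (auto simp: m_def)
    \<comment> \<open>Exponent 0 has degree below \<open>n\<close> because \<open>n \<ge> 1\<close>,
      so constant coefficients can be compared: 1 on one side, 0 on the other.\<close>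
    then show False
      using n order_idealD[of p 1 0] by (auto simp: trunc_eq_iff dest!: spec[of _ 0])
  qed
  ultimately show ?thesis using cK by (intro bexI[of _ u] conjI ballI) simp_all
qed

text \<open>The socle generator is \<open>y0 = i u\<close>. If \<open>z \<noteq> 0\<close> is killed
  by the maximal ideal, essentiality makes the cyclic submodule generated by \<open>z\<close> meet
  the image of \<open>K\<close>; a nonzero common element is a scalar multiple both of
  \<open>z\<close> and of \<open>i u\<close>.\<close>

lemma trunc_envelope_of_injective_envelope:
  fixes E :: "(('v::finite, 'k::field) mpoly set, 'b) module"
    and K :: "(('v, 'k) mpoly set, 'c) module"
  assumes E: "injective_envelope (trunc_ring n) K E"
    and u_in: "u \<in> carrier K" and u: "u \<noteq> \<zero>\<^bsub>K\<^esub>" "carrier K = range (\<lambda>p. trunc n p \<odot>\<^bsub>K\<^esub> u)"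
      "\<And>p. p \<in> order_ideal 1 \<Longrightarrow> trunc n p \<odot>\<^bsub>K\<^esub> u = \<zero>\<^bsub>K\<^esub>"
  shows "\<exists>y0. trunc_envelope n E y0"
proof -
  let ?R = "trunc_ring n :: ('v, 'k) mpoly set ring"
  obtain i where inj: "injective_module ?R E" and K: "Module.module ?R K"
    and i: "i \<in> LinearCombinations.module_hom ?R K E" "inj_on i (carrier K)"
    and ess: "essential_submodule ?R (i ` carrier K) E"
    using E by (auto simp: injective_envelope_def)
  interpret K: trunc_module n K by (rule trunc_module.intro) (rule K)
  interpret E: trunc_module n E
    by (rule trunc_module.intro) (use inj in \<open>simp add: injective_module_def\<close>)
  interpret i: mod_hom ?R K E i
    by (intro mod_hom.intro mod_hom_axioms.intro K E.module i(1))
  have span_u: "\<exists>c. w = E.act (mpoly_const c) (i u)" if w: "w \<in> i ` carrier K" for w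
  proof -
    obtain p where "w = i (K.act p u)"
      using w u(2) by auto
    then have "w = i (K.act (mpoly_const (Poly_Mapping.lookup p 0)) u)"
      by (simp only: K.act_const_term[OF u_in u(3), of p])
    then show ?thesis using i.f_smult[OF _ u_in] by auto
  qed
  have y0: "i u \<in> carrier E" using u_in by auto
  have "trunc_envelope n E (i u)"
  proof (intro trunc_envelope.intro trunc_envelope_axioms.intro E.trunc_module_axioms inj y0)
    show "i u \<noteq> \<zero>\<^bsub>E\<^esub>"
      using u(1) i(2) u_in i.f0_is_0 by (metis K.Mod.M.zero_closed inj_onD)
    show m_y0: "E.act p (i u) = \<zero>\<^bsub>E\<^esub>" if "p \<in> order_ideal 1" for p
      using i.f_smult[of "trunc n p" u] u_in u(3)[OF that] by simp
    fix z assume z: "z \<in> carrier E" and mz: "\<And>p. p \<in> order_ideal 1 \<Longrightarrow> E.act p z = \<zero>\<^bsub>E\<^esub>"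
    let ?N = "(\<lambda>r. r \<odot>\<^bsub>E\<^esub> z) ` carrier ?R"
    show "\<exists>c. z = E.act (mpoly_const c) (i u)"
    proof (cases "z = \<zero>\<^bsub>E\<^esub>")
      case True
      then have "z = E.act (mpoly_const 0) (i u)" using y0 by (simp add: mpoly_const_def)
      then show ?thesis by blast
    next
      case False
      have "LinearCombinations.submodule ?R ?N E"
      proof (unfold_locales)
        show "\<zero>\<^bsub>E\<^esub> \<in> ?N" using z by (auto intro!: image_eqI[of _ _ "\<zero>\<^bsub>?R\<^esub>"])
      qed (use z in \<open>auto simp flip: E.Mod.smult_l_distr E.Mod.smult_assoc1\<close>)
      moreover have "z \<in> ?N" using z by (auto intro!: image_eqI[of _ _ "\<one>\<^bsub>?R\<^esub>"])
      then have "?N \<noteq> {\<zero>\<^bsub>E\<^esub>}" using False by auto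
      ultimately have "?N \<inter> i ` carrier K \<noteq> {\<zero>\<^bsub>E\<^esub>}"
        using ess by (auto simp: essential_submodule_def)
      moreover have "\<zero>\<^bsub>E\<^esub> \<in> ?N"
        using z by (auto intro!: image_eqI[of _ _ "\<zero>\<^bsub>?R\<^esub>"])
      moreover have "\<zero>\<^bsub>E\<^esub> \<in> i ` carrier K"
        using i.f0_is_0 by (intro image_eqI[of _ _ "\<zero>\<^bsub>K\<^esub>"]) auto
      ultimately obtain w where w: "w \<in> ?N" "w \<in> i ` carrier K" "w \<noteq> \<zero>\<^bsub>E\<^esub>" by blast
      obtain p where p: "w = E.act p z" using w(1) by (auto simp: carrier_trunc_ring)
      obtain d where d: "w = E.act (mpoly_const d) (i u)" using span_u[OF w(2)] by blast
      define c where "c = Poly_Mapping.lookup p 0"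
      have c: "w = E.act (mpoly_const c) z"
        using E.act_const_term[OF z mz] p by (simp add: c_def)
      \<comment> \<open>The element \<open>w\<close> is nonzero, so the constant \<open>c\<close> by
        which it is obtained from \<open>z\<close> can be inverted, which puts \<open>z\<close>
        itself on the line of \<open>i u\<close>.\<close>
      then have "c \<noteq> 0" using w(3) z by (auto simp: mpoly_const_def)
      then have "z = E.act (mpoly_const (inverse c)) (E.act (mpoly_const d) (i u))"
        using E.act_const_inverse[OF z, of c] c d by simp
      also have "\<dots> = E.act (mpoly_const (inverse c * d)) (i u)"
        using y0 by (subst E.act_mult[symmetric]) (simp_all add: mpoly_const_def mult_single)
      finally show ?thesis by blast
    qed
  qed
  then show ?thesis by blast
qed

section \<open>The dual of the truncated polynomial ring\<close>

text \<open>Since every functional in the carrier vanishes on \<open>order_ideal n\<close>, the scalar product does not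
  depend on the representative chosen by \<open>SOME\<close>.\<close>

definition dual_module :: "nat \<Rightarrow> (('v::finite, 'k::field) mpoly set, ('v, 'k) mpoly \<Rightarrow> 'k) module" where
  "dual_module n =
     \<lparr>carrier = {f. (\<forall>p q. f (p + q) = f p + f q) \<and> (\<forall>c p. f (mpoly_const c * p) = c * f p) \<and>
        (\<forall>p\<in>order_ideal n. f p = 0)},
      monoid.mult = undefined, monoid.one = undefined,
      ring.zero = (\<lambda>p. 0), ring.add = (\<lambda>f g p. f p + g p),
      module.smult = (\<lambda>r f q. f ((SOME p. r = trunc n p) * q))\<rparr>"

lemma dual_module_simps [simp]:
  "\<zero>\<^bsub>dual_module n\<^esub> = (\<lambda>p. 0)"
  "f \<oplus>\<^bsub>dual_module n\<^esub> g = (\<lambda>p. f p + g p)"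
  by (simp_all add: dual_module_def)

lemma carrier_dual_module_iff:
  "f \<in> carrier (dual_module n) \<longleftrightarrow> (\<forall>p q. f (p + q) = f p + f q) \<and>
     (\<forall>c p. f (mpoly_const c * p) = c * f p) \<and> (\<forall>p\<in>order_ideal n. f p = 0)"
  by (simp add: dual_module_def)

lemma dual_module_smult:
  fixes f :: "('v::finite, 'k::field) mpoly \<Rightarrow> 'k"
  assumes "f \<in> carrier (dual_module n)"
  shows "trunc n p \<odot>\<^bsub>dual_module n\<^esub> f = (\<lambda>q. f (p * q))"
proof
  fix q
  define p' where "p' = (SOME p'. trunc n p = trunc n p')"
  have "trunc n p = trunc n p'"
    unfolding p'_def by (rule someI_ex) blast
  then have "p' - p \<in> order_ideal n"
    by (simp add: trunc_eq_iff order_ideal_def lookup_minus)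
  then have "(p' - p) * q \<in> order_ideal n"
    using mult_in_order_ideal[of "p' - p" n q 0] by simp
  then have "f ((p' - p) * q + p * q) = f (p * q)"
    using assms by (simp add: carrier_dual_module_iff)
  then show "(trunc n p \<odot>\<^bsub>dual_module n\<^esub> f) q = f (p * q)"
    by (simp add: dual_module_def algebra_simps flip: p'_def)
qed

lemma module_dual_module: "Module.module (trunc_ring n) (dual_module n :: (('v::finite, 'k::field) mpoly set, _) module)"
proof (intro module.intro module_axioms.intro cring_trunc_ring)
  let ?D = "dual_module n :: (('v, 'k) mpoly set, _) module"
  show "abelian_group ?D"
  proof (rule abelian_groupI)
    fix f assume "f \<in> carrier ?D"
    then have "(\<lambda>p. - f p) \<in> carrier ?D"
      by (simp add: carrier_dual_module_iff)
    then show "\<exists>g\<in>carrier ?D. g \<oplus>\<^bsub>?D\<^esub> f = \<zero>\<^bsub>?D\<^esub>"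
      by (intro bexI[of _ "\<lambda>p. - f p"]) simp_all
  qed (auto simp: carrier_dual_module_iff algebra_simps)
next
  let ?R = "trunc_ring n :: ('v, 'k) mpoly set ring"
  let ?D = "dual_module n :: (('v, 'k) mpoly set, _) module"
  have mult: "(\<lambda>q. f (p * q)) \<in> carrier ?D" if "f \<in> carrier ?D" for f p
    using that mult_in_order_ideal[of p 0 _ n]
    by (auto simp: carrier_dual_module_iff distrib_left mult.left_commute[of p])
  have add: "(\<lambda>q. f q + g q) \<in> carrier ?D" if "f \<in> carrier ?D" "g \<in> carrier ?D" for f g
    using that by (auto simp: carrier_dual_module_iff algebra_simps)
  fix r s f g assume "r \<in> carrier ?R" and f: "f \<in> carrier ?D"
  then obtain p where p: "r = trunc n p" by (auto simp: carrier_trunc_ring)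
  show "r \<odot>\<^bsub>?D\<^esub> f \<in> carrier ?D"
    using f by (simp add: p dual_module_smult mult)
  show "r \<odot>\<^bsub>?D\<^esub> (f \<oplus>\<^bsub>?D\<^esub> g) = r \<odot>\<^bsub>?D\<^esub> f \<oplus>\<^bsub>?D\<^esub> r \<odot>\<^bsub>?D\<^esub> g" if "g \<in> carrier ?D"
    using f that by (simp add: p dual_module_smult add)
  assume "s \<in> carrier ?R"
  then obtain p' where p': "s = trunc n p'" by (auto simp: carrier_trunc_ring)
  show "(r \<oplus>\<^bsub>?R\<^esub> s) \<odot>\<^bsub>?D\<^esub> f = r \<odot>\<^bsub>?D\<^esub> f \<oplus>\<^bsub>?D\<^esub> s \<odot>\<^bsub>?D\<^esub> f"
    using f by (simp add: p p' dual_module_smult distrib_right) (simp add: carrier_dual_module_iff)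
  show "(r \<otimes>\<^bsub>?R\<^esub> s) \<odot>\<^bsub>?D\<^esub> f = r \<odot>\<^bsub>?D\<^esub> (s \<odot>\<^bsub>?D\<^esub> f)"
    using f by (simp add: p p' dual_module_smult mult) (simp add: mult_ac)
qed (simp add: trunc_ring_one dual_module_smult)

lemma lookup_in_dual_module:
  "exp_degree a < n \<Longrightarrow> (\<lambda>p. Poly_Mapping.lookup p a) \<in> carrier (dual_module n)"
  by (auto simp: carrier_dual_module_iff lookup_add mpoly_const_def order_ideal_def)

lemma sum_lookup_in_dual_module:
  assumes "\<And>a. a \<in> A \<Longrightarrow> exp_degree a < n"
  shows "(\<lambda>p. \<Sum>a\<in>A. c a * Poly_Mapping.lookup p a) \<in> carrier (dual_module n)"
  using assms
  by (auto simp: carrier_dual_module_iff lookup_add mpoly_const_def order_ideal_def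
      sum.distrib distrib_left sum_distrib_left mult.left_commute intro!: sum.neutral)

text \<open>The coefficient functionals of degree below \<open>n\<close> are the basis dual to the
  monomials. By linearity it suffices to compare on monomials, and on those of degree at least
  \<open>n\<close> both sides vanish.\<close>

lemma dual_module_eq_sum_lookup:
  fixes f :: "('v::finite, 'k::field) mpoly \<Rightarrow> 'k"
  assumes f: "f \<in> carrier (dual_module n)"
  shows "f = (\<lambda>p. \<Sum>a | exp_degree a < n. f (Poly_Mapping.single a 1) * Poly_Mapping.lookup p a)"
proof
  fix p :: "('v, 'k) mpoly"
  show "f p = (\<Sum>a | exp_degree a < n. f (Poly_Mapping.single a 1) * Poly_Mapping.lookup p a)"
  proof -
    have "p \<in> order_ideal 0" by simp
    then show ?thesis
    proof (induction rule: order_ideal_induct)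
      case zero
      then show ?case using f by (simp add: carrier_dual_module_iff)
    next
      case (add p q)
      then show ?case using f by (simp add: carrier_dual_module_iff lookup_add distrib_left sum.distrib)
    next
      case (monomial b c)
      have "f (mpoly_const c * Poly_Mapping.single b 1) = c * f (Poly_Mapping.single b 1)"
        using f by (simp only: carrier_dual_module_iff)
      then have *: "f (Poly_Mapping.single b c) = c * f (Poly_Mapping.single b 1)"
        by (simp add: mpoly_const_def mult_single)
      have "f (Poly_Mapping.single b c) = 0" if "\<not> exp_degree b < n"
        using f that single_in_order_ideal[of n b c] by (simp add: carrier_dual_module_iff)
      then show ?case
        by (auto simp: lookup_single when_def * if_distrib[of "\<lambda>x. _ * x"] sum.delta finite_exp_degree_less cong: if_cong)
    qed
  qed
qed

lemma dual_module_induct [consumes 1, case_names zero add lookup]: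
  fixes f :: "('v::finite, 'k::field) mpoly \<Rightarrow> 'k"
  assumes f: "f \<in> carrier (dual_module n)"
    and zero: "P (\<lambda>p. 0)"
    and add: "\<And>f g. f \<in> carrier (dual_module n) \<Longrightarrow> g \<in> carrier (dual_module n) \<Longrightarrow> P f \<Longrightarrow> P g \<Longrightarrow>
      P (\<lambda>p. f p + g p)"
    and lookup: "\<And>a c. exp_degree a < n \<Longrightarrow> P (\<lambda>p. c * Poly_Mapping.lookup p a)"
  shows "P f"
proof -
  define c where "c a = f (Poly_Mapping.single a 1)" for a
  have "P (\<lambda>p. \<Sum>a\<in>A. c a * Poly_Mapping.lookup p a)" if "finite A" "A \<subseteq> {a. exp_degree a < n}" for A
    using that
  proof (induction A rule: finite_induct)
    case (insert a A)
    have "(\<lambda>p. \<Sum>b\<in>A. c b * Poly_Mapping.lookup p b) \<in> carrier (dual_module n)"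
      using insert by (intro sum_lookup_in_dual_module) auto
    moreover have "(\<lambda>p. c a * Poly_Mapping.lookup p a) \<in> carrier (dual_module n)"
      using sum_lookup_in_dual_module[of "{a}" n c] insert by simp
    ultimately have "P (\<lambda>p. c a * Poly_Mapping.lookup p a + (\<Sum>b\<in>A. c b * Poly_Mapping.lookup p b))"
      using insert by (intro add lookup) auto
    with insert show ?case by simp
  qed (simp add: zero)
  from this[OF finite_exp_degree_less order_refl] dual_module_eq_sum_lookup[OF f]
  show ?thesis by (simp add: c_def)
qed

section \<open>The map from the dual module onto the envelope\<close>

context trunc_envelope
begin

text \<open>Otherwise the invertible constant \<open>c - d\<close> would kill \<open>y0\<close>,
  which is nonzero.\<close>

lemma act_const_y0_inject:
  assumes "act (mpoly_const c) y0 = act (mpoly_const d) y0"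
  shows "c = d"
proof (rule ccontr)
  assume "c \<noteq> d"
  have "act (mpoly_const (c - d) + mpoly_const d) y0 = act (mpoly_const d) y0"
    using assms by (simp add: mpoly_const_def flip: single_add)
  then have "act (mpoly_const (c - d)) y0 = \<zero>\<^bsub>M\<^esub>"
    using y0 by (simp add: act_add)
  then have "y0 = act (mpoly_const (inverse (c - d))) \<zero>\<^bsub>M\<^esub>"
    using act_const_inverse[of y0 "c - d"] y0 \<open>c \<noteq> d\<close> by simp
  with y0 show False by simp
qed

text \<open>The map is an extension, by injectivity, of the identification of the socle of \<open>dual_module n\<close>
  with that of \<open>M\<close>.\<close>

lemma dual_module_hom_exists:
  assumes n: "n \<ge> 1"
  shows "\<exists>h \<in> LinearCombinations.module_hom (trunc_ring n) (dual_module n) M.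
    h (\<lambda>p. Poly_Mapping.lookup p 0) = y0"
proof -
  let ?R = "trunc_ring n :: ('v, 'k) mpoly set ring"
  let ?D = "dual_module n :: (('v, 'k) mpoly set, _) module"
  interpret dual: Module.module ?R ?D by (rule module_dual_module)
  \<comment> \<open>The socle of the dual: the scalar multiples of the constant-coefficient
    functional. It lies in the carrier because \<open>n \<ge> 1\<close>.\<close>
  define L where "L = range (\<lambda>c (p :: ('v, 'k) mpoly). c * Poly_Mapping.lookup p 0)"
  have L_D: "f \<in> carrier ?D" if "f \<in> L" for f
    using that n sum_lookup_in_dual_module[of "{0}" n] by (auto simp: L_def)
  have smult_L: "trunc n p \<odot>\<^bsub>?D\<^esub> f = (\<lambda>q. f 1 * Poly_Mapping.lookup p 0 * Poly_Mapping.lookup q 0)"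
    if "f \<in> L" for p f
    using that L_D[OF that] by (auto simp: L_def dual_module_smult)
  have "LinearCombinations.submodule ?R L ?D"
  proof unfold_locales
    show "L \<subseteq> carrier ?D" using L_D by auto
    show "\<zero>\<^bsub>?D\<^esub> \<in> L" by (auto simp: L_def intro: image_eqI[of _ _ 0])
    show "f \<oplus>\<^bsub>?D\<^esub> g \<in> L" if "f \<in> L" "g \<in> L" for f g
      using that by (auto simp: L_def simp flip: distrib_right)
    show "r \<odot>\<^bsub>?D\<^esub> f \<in> L" if rf: "r \<in> carrier ?R" "f \<in> L" for r f
    proof -
      obtain p where "r = trunc n p" using rf by (auto simp: carrier_trunc_ring)
      then show ?thesis using smult_L[OF rf(2), of p] by (auto simp: L_def)
    qed
  qed
  then have L: "Module.module ?R (?D\<lparr>carrier := L\<rparr>)"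
    by (rule dual.submodule_is_module)
  have incl: "(\<lambda>f. f) \<in> LinearCombinations.module_hom ?R (?D\<lparr>carrier := L\<rparr>) ?D"
    using L_D by (auto simp: LinearCombinations.module_hom_def)
  \<comment> \<open>For \<open>f\<close> in \<open>L\<close> the value \<open>f 1\<close> is the
    scalar by which \<open>f\<close> multiplies the constant-coefficient functional, so this map
    sends that functional to \<open>y0\<close>.\<close>
  have g: "(\<lambda>f. act (mpoly_const (f 1)) y0) \<in> LinearCombinations.module_hom ?R (?D\<lparr>carrier := L\<rparr>) M"
    unfolding LinearCombinations.module_hom_def
  proof (intro CollectI conjI allI impI; (elim conjE)?)
    fix r f assume "r \<in> carrier ?R" "f \<in> carrier (?D\<lparr>carrier := L\<rparr>)"
    then obtain p where r: "r = trunc n p" and f: "f \<in> L" by (auto simp: carrier_trunc_ring)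
    have "r \<odot>\<^bsub>?D\<lparr>carrier := L\<rparr>\<^esub> f = (\<lambda>q. f 1 * Poly_Mapping.lookup p 0 * Poly_Mapping.lookup q 0)"
      using smult_L[OF f] r by simp
    moreover have "r \<odot>\<^bsub>M\<^esub> act (mpoly_const (f 1)) y0 = act (mpoly_const (f 1) * p) y0"
      using y0 by (simp add: r act_mult mult.commute)
    moreover have "\<dots> = act (mpoly_const (f 1)) (act (mpoly_const (Poly_Mapping.lookup p 0)) y0)"
      using y0 order_ideal_y0 by (simp only: act_mult act_const_term[of y0 p])
    ultimately show "act (mpoly_const ((r \<odot>\<^bsub>?D\<lparr>carrier := L\<rparr>\<^esub> f) 1)) y0 = r \<odot>\<^bsub>M\<^esub> act (mpoly_const (f 1)) y0"
      using y0 by (simp add: mpoly_const_def mult_single flip: act_mult)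
  qed (use y0 in \<open>auto simp: mpoly_const_def single_add act_add\<close>)
  obtain h where h: "h \<in> LinearCombinations.module_hom ?R ?D M"
    and h_L: "\<And>f. f \<in> L \<Longrightarrow> h f = act (mpoly_const (f 1)) y0"
    using injective_module_extend[OF injective L module_dual_module incl _ g] by auto
  have "(\<lambda>p. Poly_Mapping.lookup p 0) \<in> L"
    by (auto simp: L_def intro: image_eqI[of _ _ 1])
  from h_L[OF this] have "h (\<lambda>p. Poly_Mapping.lookup p 0) = y0"
    using y0 by (simp add: mpoly_const_def)
  with h show ?thesis by blast
qed

end

locale trunc_envelope_dual = trunc_envelope n M y0
  for n :: nat and M :: "(('v::finite, 'k::field) mpoly set, 'b) module" and y0 +
  fixes h :: "(('v, 'k) mpoly \<Rightarrow> 'k) \<Rightarrow> 'b"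
  assumes n_pos: "n \<ge> 1"
    and h: "h \<in> LinearCombinations.module_hom (trunc_ring n) (dual_module n) M"
    and h_lookup_0: "h (\<lambda>p. Poly_Mapping.lookup p 0) = y0"
begin

lemma h_closed [simp]: "f \<in> carrier (dual_module n) \<Longrightarrow> h f \<in> carrier M"
  using LinearCombinations.module_hom_closed[OF h] by auto

lemma h_add:
  "f \<in> carrier (dual_module n) \<Longrightarrow> g \<in> carrier (dual_module n) \<Longrightarrow> h (\<lambda>p. f p + g p) = h f \<oplus>\<^bsub>M\<^esub> h g"
  using LinearCombinations.module_hom_add[OF h, of f g] by simp

lemma h_smult: "f \<in> carrier (dual_module n) \<Longrightarrow> h (\<lambda>q. f (p * q)) = act p (h f)"
  using LinearCombinations.module_hom_smult[OF h, of "trunc n p" f] by (simp add: dual_module_smult)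

lemma h_const_smult: "f \<in> carrier (dual_module n) \<Longrightarrow> h (\<lambda>q. c * f q) = act (mpoly_const c) (h f)"
  using h_smult[of f "mpoly_const c"] by (simp add: carrier_dual_module_iff)

lemma zero_in_dual_module: "(\<lambda>p. 0) \<in> carrier (dual_module n)"
  by (simp add: carrier_dual_module_iff)

lemma h_zero: "h (\<lambda>p. 0) = \<zero>\<^bsub>M\<^esub>"
  using h_const_smult[OF zero_in_dual_module, of 0] act_zero[OF h_closed[OF zero_in_dual_module]]
  by (simp add: mpoly_const_def)

text \<open>The elements \<open>y\<^sub>a\<close>: images of the dual basis of the monomials. They
  behave like the inverse monomials of Macaulay's inverse systems.\<close>

definition dual_var :: "('v \<Rightarrow>\<^sub>0 nat) \<Rightarrow> 'b" where
  "dual_var a = h (\<lambda>p. Poly_Mapping.lookup p a)"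

lemma dual_var_closed [simp]: "exp_degree a < n \<Longrightarrow> dual_var a \<in> carrier M"
  by (simp add: dual_var_def lookup_in_dual_module)

lemma dual_var_0: "dual_var 0 = y0"
  by (simp add: dual_var_def h_lookup_0)

text \<open>The coefficient of \<open>x^b q\<close> at \<open>b + a\<close> is the coefficient of
  \<open>q\<close> at \<open>a\<close>, so multiplication by a monomial lowers the index of a
  coefficient functional.\<close>

lemma act_single_dual_var_add:
  assumes "exp_degree (b + a) < n"
  shows "act (Poly_Mapping.single b c) (dual_var (b + a)) = act (mpoly_const c) (dual_var a)"
proof -
  have "act (Poly_Mapping.single b c) (dual_var (b + a)) = h (\<lambda>q. c * Poly_Mapping.lookup q a)"
    unfolding dual_var_def using assms
    by (subst h_smult[symmetric]) (simp_all only: lookup_in_dual_module lookup_single_mult_add)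
  also have "\<dots> = act (mpoly_const c) (dual_var a)"
    unfolding dual_var_def using assms by (intro h_const_smult lookup_in_dual_module) simp
  finally show ?thesis .
qed

lemma act_single_dual_var_eq_0:
  assumes "exp_degree a < n" "\<And>d. a \<noteq> b + d"
  shows "act (Poly_Mapping.single b c) (dual_var a) = \<zero>\<^bsub>M\<^esub>"
  unfolding dual_var_def using assms
  by (subst h_smult[symmetric]) (simp_all add: lookup_in_dual_module lookup_single_mult_eq_0 h_zero)

text \<open>Induction on \<open>j\<close>. If \<open>z\<close> is killed by order
  \<open>j + 1\<close>, the monomials of degree \<open>j\<close> send it into the socle, with
  scalars \<open>c a\<close>. The functional \<open>w\<close> with these coefficients reproduces
  them, so \<open>z\<close> minus \<open>h w\<close> is killed by order \<open>j\<close> and the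
  induction hypothesis applies to it.\<close>

lemma h_surj_aux:
  assumes "j \<le> n" "z \<in> carrier M" "\<And>p. p \<in> order_ideal j \<Longrightarrow> act p z = \<zero>\<^bsub>M\<^esub>"
  shows "z \<in> h ` carrier (dual_module n)"
  using assms
proof (induction j arbitrary: z)
  case 0
  then have "act 1 z = \<zero>\<^bsub>M\<^esub>" by (simp only: order_ideal_0 UNIV_I)
  then have "z = h (\<lambda>p. 0)" using 0(2) h_zero by simp
  then show ?case using zero_in_dual_module by blast
next
  case (Suc j)
  let ?T = "{a :: 'v \<Rightarrow>\<^sub>0 nat. exp_degree a = j}"
  have "\<exists>c. act (Poly_Mapping.single a 1) z = act (mpoly_const c) y0" if "a \<in> ?T" for a
  proof (rule socle)
    fix p :: "('v, 'k) mpoly" assume "p \<in> order_ideal 1"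
    then have "p * Poly_Mapping.single a 1 \<in> order_ideal (1 + j)"
      using that by (intro mult_in_order_ideal single_in_order_ideal) simp_all
    then have "act (p * Poly_Mapping.single a 1) z = \<zero>\<^bsub>M\<^esub>"
      by (intro Suc.prems(3)) (simp only: plus_1_eq_Suc)
    then show "act p (act (Poly_Mapping.single a 1) z) = \<zero>\<^bsub>M\<^esub>"
      using Suc.prems(2) by (simp add: act_mult)
  qed (use Suc.prems in simp)
  then obtain c where c: "\<And>a. a \<in> ?T \<Longrightarrow> act (Poly_Mapping.single a 1) z = act (mpoly_const (c a)) y0"
    by metis
  define w where "w = (\<lambda>p. \<Sum>a\<in>?T. c a * Poly_Mapping.lookup p a)"
  have w: "w \<in> carrier (dual_module n)"
    unfolding w_def using Suc.prems(1) by (intro sum_lookup_in_dual_module) simp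
  have act_single: "act (Poly_Mapping.single a d) (h w) = act (Poly_Mapping.single a d) z" if "exp_degree a \<ge> j" for a d
  proof (cases "exp_degree a = j")
    case True
    \<comment> \<open>Among the monomials of degree \<open>j\<close> only \<open>x^a\<close> itself
      is divisible by \<open>x^a\<close>, so \<open>w\<close> contributes just its term at
      \<open>a\<close>.\<close>
    have "Poly_Mapping.lookup (Poly_Mapping.single a d * q) b = (if b = a then d * Poly_Mapping.lookup q 0 else 0)"
      if "b \<in> ?T" for b q
    proof (cases "b = a")
      case True
      then show ?thesis using lookup_single_mult_add[of a d q 0] by simp
    next
      case False
      have "b \<noteq> a + d'" for d'
        using False \<open>exp_degree a = j\<close> that by (cases "d' = 0") auto
      with False show ?thesis by (simp add: lookup_single_mult_eq_0)
    qed
    then have "w (Poly_Mapping.single a d * q) = d * c a * Poly_Mapping.lookup q 0" for q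
      using True by (simp add: w_def if_distrib[of "\<lambda>x. _ * x"] sum.delta finite_exp_degree_eq cong: if_cong)
    then have "act (Poly_Mapping.single a d) (h w) = act (mpoly_const (d * c a)) y0"
      using h_const_smult[OF lookup_in_dual_module, of 0 "d * c a"] n_pos h_lookup_0
      by (simp flip: h_smult[OF w])
    also have "\<dots> = act (mpoly_const d) (act (Poly_Mapping.single a 1) z)"
      using y0 True by (simp add: c mpoly_const_def mult_single flip: act_mult)
    also have "\<dots> = act (Poly_Mapping.single a d) z"
      using Suc.prems(2) by (simp add: mpoly_const_def mult_single flip: act_mult)
    finally show ?thesis .
  next
    case False
    \<comment> \<open>Now \<open>a\<close> has degree above \<open>j\<close>: its monomial divides
      none of the monomials occurring in \<open>w\<close>, and it kills \<open>z\<close> by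
      assumption, so both sides are zero.\<close>
    have "Poly_Mapping.lookup (Poly_Mapping.single a d * q) b = 0" if "b \<in> ?T" for b q
      by (rule lookup_single_mult_eq_0) (use False that \<open>exp_degree a \<ge> j\<close> in auto)
    then have "w (Poly_Mapping.single a d * q) = 0" for q
      by (simp add: w_def)
    then have "act (Poly_Mapping.single a d) (h w) = \<zero>\<^bsub>M\<^esub>"
      by (simp add: h_zero flip: h_smult[OF w])
    moreover have "act (Poly_Mapping.single a d) z = \<zero>\<^bsub>M\<^esub>"
      using False that by (intro Suc.prems(3) single_in_order_ideal) simp
    ultimately show ?thesis by simp
  qed
  have "act p (h w) = act p z" if "p \<in> order_ideal j" for p
    using that
    by (induction rule: order_ideal_induct) (simp_all add: act_single w act_add Suc.prems(2))
  then have "z \<ominus>\<^bsub>M\<^esub> h w \<in> h ` carrier (dual_module n)"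
    using Suc.prems w
    by (intro Suc.IH) (simp_all add: a_minus_def Mod.smult_r_distr Mod.smult_r_minus Mod.M.r_neg)
  then obtain f where f: "f \<in> carrier (dual_module n)" "z \<ominus>\<^bsub>M\<^esub> h w = h f" by auto
  have "z = (z \<ominus>\<^bsub>M\<^esub> h w) \<oplus>\<^bsub>M\<^esub> h w"
    using Suc.prems w by (simp add: a_minus_def Mod.M.a_assoc Mod.M.l_neg)
  then have "z = h (\<lambda>p. f p + w p)"
    using f w by (simp add: h_add)
  moreover have "(\<lambda>p. f p + w p) \<in> carrier (dual_module n)"
    using f w by (auto simp: carrier_dual_module_iff algebra_simps)
  ultimately show ?case by blast
qed

lemma h_surj: "z \<in> carrier M \<Longrightarrow> z \<in> h ` carrier (dual_module n)"
  by (rule h_surj_aux[of n]) (simp_all add: act_order_ideal)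

text \<open>Surjectivity of \<open>h\<close> carries the spanning family of coefficient functionals
  over to \<open>M\<close>.\<close>

lemma dual_var_induct [consumes 1, case_names zero add dual_var]:
  assumes z: "z \<in> carrier M" and zero: "P \<zero>\<^bsub>M\<^esub>"
    and add: "\<And>x y. x \<in> carrier M \<Longrightarrow> y \<in> carrier M \<Longrightarrow> P x \<Longrightarrow> P y \<Longrightarrow> P (x \<oplus>\<^bsub>M\<^esub> y)"
    and dual_var: "\<And>a c. exp_degree a < n \<Longrightarrow> P (act (mpoly_const c) (dual_var a))"
  shows "P z"
proof -
  obtain f where f: "f \<in> carrier (dual_module n)" "z = h f" using h_surj[OF z] by auto
  from f(1) have "P (h f)"
  proof (induction rule: dual_module_induct)
    case (lookup a c)
    then show ?case
      using dual_var[of a c] by (simp add: h_const_smult lookup_in_dual_module dual_var_def)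
  qed (simp_all add: h_zero zero h_add add)
  with f show ?thesis by simp
qed

text \<open>For \<open>a\<close> of degree \<open>n - 1\<close> this is the coordinate of
  \<open>z\<close> along \<open>dual_var a\<close> modulo the maximal ideal times \<open>M\<close>,
  read off by moving \<open>z\<close> into the socle with \<open>x^a\<close>.\<close>

definition socle_coeff :: "('v \<Rightarrow>\<^sub>0 nat) \<Rightarrow> 'b \<Rightarrow> 'k" where
  "socle_coeff a z = (THE c. act (Poly_Mapping.single a 1) z = act (mpoly_const c) y0)"

lemma socle_coeff_eqI:
  assumes "act (Poly_Mapping.single a 1) z = act (mpoly_const c) y0"
  shows "socle_coeff a z = c"
  unfolding socle_coeff_def using assms by (rule the_equality) (simp add: assms act_const_y0_inject)

text \<open>Multiplying a monomial of degree \<open>n - 1\<close> by the maximal ideal gives order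
  \<open>n\<close>, which acts as zero; hence \<open>x^a z\<close> lies in the socle.\<close>

lemma act_single_eq_socle_coeff:
  assumes "z \<in> carrier M" "exp_degree a = n - 1"
  shows "act (Poly_Mapping.single a 1) z = act (mpoly_const (socle_coeff a z)) y0"
proof -
  have "\<exists>c. act (Poly_Mapping.single a 1) z = act (mpoly_const c) y0"
  proof (rule socle)
    fix p :: "('v, 'k) mpoly" assume "p \<in> order_ideal 1"
    then have "p * Poly_Mapping.single a 1 \<in> order_ideal (1 + (n - 1))"
      using assms by (intro mult_in_order_ideal single_in_order_ideal) simp_all
    then have "act (p * Poly_Mapping.single a 1) z = \<zero>\<^bsub>M\<^esub>"
      using n_pos assms by (intro act_order_ideal) simp_all
    then show "act p (act (Poly_Mapping.single a 1) z) = \<zero>\<^bsub>M\<^esub>"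
      using assms by (simp add: act_mult)
  qed (use assms in simp)
  then show ?thesis using socle_coeff_eqI by metis
qed

lemma socle_coeff_add:
  assumes "x \<in> carrier M" "y \<in> carrier M" "exp_degree a = n - 1"
  shows "socle_coeff a (x \<oplus>\<^bsub>M\<^esub> y) = socle_coeff a x + socle_coeff a y"
  by (rule socle_coeff_eqI)
    (use assms y0 in \<open>simp add: Mod.smult_r_distr act_single_eq_socle_coeff mpoly_const_def single_add act_add\<close>)

text \<open>Actions commute, and on the socle \<open>p\<close> acts through its constant term. In
  particular the coordinate vanishes on the maximal ideal times \<open>M\<close>.\<close>

lemma socle_coeff_act:
  assumes "z \<in> carrier M" "exp_degree a = n - 1"
  shows "socle_coeff a (act p z) = Poly_Mapping.lookup p 0 * socle_coeff a z"
proof (rule socle_coeff_eqI)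
  have "act (Poly_Mapping.single a 1) (act p z) = act p (act (Poly_Mapping.single a 1) z)"
    using assms by (simp add: mult.commute flip: act_mult)
  also have "\<dots> = act (p * mpoly_const (socle_coeff a z)) y0"
    using assms y0 by (simp add: act_single_eq_socle_coeff act_mult)
  also have "\<dots> = act (mpoly_const (Poly_Mapping.lookup p 0 * socle_coeff a z)) y0"
    using y0 order_ideal_y0 by (subst act_const_term) (simp_all add: mpoly_const_def)
  finally show "act (Poly_Mapping.single a 1) (act p z) = act (mpoly_const (Poly_Mapping.lookup p 0 * socle_coeff a z)) y0" .
qed

lemma socle_coeff_dual_var:
  assumes "exp_degree a = n - 1" "exp_degree b = n - 1"
  shows "socle_coeff a (dual_var b) = (if a = b then 1 else 0)"
proof (rule socle_coeff_eqI)
  have b: "exp_degree b < n" using assms n_pos by simp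
  show "act (Poly_Mapping.single a 1) (dual_var b) = act (mpoly_const (if a = b then 1 else 0)) y0"
  proof (cases "a = b")
    case True
    then show ?thesis using act_single_dual_var_add[of b 0 1] b by (simp add: dual_var_0)
  next
    case False
    have "b \<noteq> a + d" for d
      using False assms by (cases "d = 0") auto
    then show ?thesis using False b y0 by (simp add: act_single_dual_var_eq_0 mpoly_const_def)
  qed
qed

end

section \<open>Homomorphisms from the envelope to the ring\<close>

lemma trunc_coeff_mult_single_add:
  assumes "r \<in> carrier (trunc_ring n)" "exp_degree (b + d) < n"
  shows "trunc_coeff n (trunc n (Poly_Mapping.single b c) \<otimes>\<^bsub>trunc_ring n\<^esub> r) (b + d) = c * trunc_coeff n r d"
proof -
  obtain p where "r = trunc n p" using assms(1) by (auto simp: carrier_trunc_ring)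
  with assms(2) show ?thesis by simp
qed

lemma trunc_coeff_mult_single_eq_0:
  assumes "r \<in> carrier (trunc_ring n)" "exp_degree a < n" "\<And>d. a \<noteq> b + d"
  shows "trunc_coeff n (trunc n (Poly_Mapping.single b c) \<otimes>\<^bsub>trunc_ring n\<^esub> r) a = 0"
proof -
  obtain p where "r = trunc n p" using assms(1) by (auto simp: carrier_trunc_ring)
  with assms(2,3) show ?thesis by (simp add: lookup_single_mult_eq_0)
qed

lemma trunc_coeff_add:
  assumes "r \<in> carrier (trunc_ring n)" "s \<in> carrier (trunc_ring n)" "exp_degree a < n"
  shows "trunc_coeff n (r \<oplus>\<^bsub>trunc_ring n\<^esub> s) a = trunc_coeff n r a + trunc_coeff n s a"
  using assms by (auto simp: carrier_trunc_ring lookup_add)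

lemma trunc_mult_eq_0:
  fixes p :: "('v::finite, 'k::field) mpoly"
  assumes "r \<in> carrier (trunc_ring n)" "p \<in> order_ideal i"
    and "\<And>a. exp_degree a < n - i \<Longrightarrow> trunc_coeff n r a = 0"
  shows "trunc n p \<otimes>\<^bsub>trunc_ring n\<^esub> r = \<zero>\<^bsub>trunc_ring n\<^esub>"
proof -
  obtain q where q: "r = trunc n q" using assms(1) by (auto simp: carrier_trunc_ring)
  have "q \<in> order_ideal (n - i)"
    using assms(3) by (intro order_idealI) (simp add: q)
  then have "p * q \<in> order_ideal (i + (n - i))"
    using assms(2) by (intro mult_in_order_ideal)
  \<comment> \<open>Subtraction is truncated, so \<open>i + (n - i)\<close> may exceed
    \<open>n\<close>; only monotonicity is available.\<close>
  then have "p * q \<in> order_ideal n"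
    by (rule order_ideal_mono) simp
  then show ?thesis by (simp add: q trunc_ring_zero trunc_eq_0_iff)
qed

lemma regular_module_simps [simp]:
  "carrier (regular_module R) = carrier R"
  "x \<oplus>\<^bsub>regular_module R\<^esub> y = x \<oplus>\<^bsub>R\<^esub> y"
  "\<zero>\<^bsub>regular_module R\<^esub> = \<zero>\<^bsub>R\<^esub>"
  "x \<odot>\<^bsub>regular_module R\<^esub> y = x \<otimes>\<^bsub>R\<^esub> y"
  by (simp_all add: regular_module_def)

locale trunc_envelope_functional = trunc_envelope_dual n M y0 h
  for n :: nat and M :: "(('v::finite, 'k::field) mpoly set, 'b) module" and y0 h +
  fixes \<phi>
  assumes card_vars: "CARD('v) \<ge> 2"
    and hom: "\<phi> \<in> LinearCombinations.module_hom (trunc_ring n) M (regular_module (trunc_ring n))"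
begin

lemma hom_closed [simp]: "z \<in> carrier M \<Longrightarrow> \<phi> z \<in> carrier (trunc_ring n)"
  using LinearCombinations.module_hom_closed[OF hom] by auto

lemma hom_act: "z \<in> carrier M \<Longrightarrow> \<phi> (act p z) = trunc n p \<otimes>\<^bsub>trunc_ring n\<^esub> \<phi> z"
  using LinearCombinations.module_hom_smult[OF hom, of "trunc n p" z] by simp

lemma hom_add: "x \<in> carrier M \<Longrightarrow> y \<in> carrier M \<Longrightarrow> \<phi> (x \<oplus>\<^bsub>M\<^esub> y) = \<phi> x \<oplus>\<^bsub>trunc_ring n\<^esub> \<phi> y"
  using LinearCombinations.module_hom_add[OF hom, of x y] by simp

lemma hom_zero: "\<phi> \<zero>\<^bsub>M\<^esub> = trunc n 0"
proof -
  have "\<phi> (act 0 y0) = trunc n 0 \<otimes>\<^bsub>trunc_ring n\<^esub> \<phi> y0" by (rule hom_act) (rule y0)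
  moreover obtain p where "\<phi> y0 = trunc n p"
    using hom_closed[OF y0(1)] by (auto simp: carrier_trunc_ring)
  ultimately show ?thesis using y0 by simp
qed

text \<open>Moving all of \<open>a\<^sub>i\<close> into another variable \<open>j\<close> reduces to the case \<open>a\<^sub>i = 0\<close>, where \<open>x\<^sub>i y\<^sub>a = 0\<close>.\<close>

lemma trunc_coeff_hom_dual_var_top:
  assumes "exp_degree a = n - 1" "exp_degree c < n - 1"
  shows "trunc_coeff n (\<phi> (dual_var a)) c = 0"
proof -
  obtain i j :: 'v where "i \<noteq> j"
    using card_vars card_le_Suc0_iff_eq[of "UNIV :: 'v set"] by fastforce
  define unit_exp :: "'v \<Rightarrow> ('v \<Rightarrow>\<^sub>0 nat)" where "unit_exp v = Poly_Mapping.single v 1" for v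
  have unit_exp: "exp_degree (unit_exp v) = 1" for v by (simp add: unit_exp_def)
  have shift: "act (Poly_Mapping.single (unit_exp v) 1) (dual_var (unit_exp v + u)) = dual_var u"
    if "exp_degree (unit_exp v + u) < n" for u v
    using act_single_dual_var_add[OF that, of 1] that by (simp add: mpoly_const_def)
  have not_unit: "d \<noteq> unit_exp v + d'" if "Poly_Mapping.lookup d v = 0" for d d' v
    using that by (auto simp: unit_exp_def lookup_add)
  show ?thesis
    using assms
  \<comment> \<open>The exponent \<open>c\<close> has to vary as well, since the step also moves one
    unit of \<open>c\<close> from \<open>j\<close> to \<open>i\<close>.\<close>
  proof (induction "Poly_Mapping.lookup a i" arbitrary: a c)
    case 0
    have "act (Poly_Mapping.single (unit_exp i) 1) (dual_var a) = \<zero>\<^bsub>M\<^esub>"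
      using 0 not_unit by (intro act_single_dual_var_eq_0) auto
    then have "trunc n (Poly_Mapping.single (unit_exp i) 1) \<otimes>\<^bsub>trunc_ring n\<^esub> \<phi> (dual_var a) = trunc n 0"
      using 0 hom_act[of "dual_var a" "Poly_Mapping.single (unit_exp i) 1"] by (simp add: hom_zero)
    \<comment> \<open>Multiplication by \<open>x_i\<close> moves coefficient \<open>c\<close> to
      \<open>unit_exp i + c\<close>. That exponent survives truncation precisely because
      \<open>c\<close> has degree below \<open>n - 1\<close>.\<close>
    then show ?case
      using trunc_coeff_mult_single_add[of "\<phi> (dual_var a)" n "unit_exp i" c 1] 0 by (simp add: unit_exp)
  next
    case (Suc t)
    define u where "u = a - unit_exp i"
    have a: "a = unit_exp i + u"
      unfolding u_def unit_exp_def using Suc.hyps(2) by (intro single_add_diff_cancel[symmetric]) simp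
    define b where "b = unit_exp j + u"
    have deg: "exp_degree a < n" "exp_degree b < n" "exp_degree b = n - 1"
      using Suc.prems a b_def by (auto simp: unit_exp)
    have "Poly_Mapping.lookup b i = t"
      using Suc.hyps(2) a \<open>i \<noteq> j\<close> by (simp add: b_def unit_exp_def lookup_add lookup_single)
    note IH = Suc.hyps(1)[OF this[symmetric] deg(3)]
    \<comment> \<open>Both sides equal \<open>dual_var u\<close>.\<close>
    have "act (Poly_Mapping.single (unit_exp i) 1) (dual_var a) = act (Poly_Mapping.single (unit_exp j) 1) (dual_var b)"
      using shift[of i u] shift[of j u] deg by (simp add: a b_def)
    then have "trunc n (Poly_Mapping.single (unit_exp i) 1) \<otimes>\<^bsub>trunc_ring n\<^esub> \<phi> (dual_var a) =
        trunc n (Poly_Mapping.single (unit_exp j) 1) \<otimes>\<^bsub>trunc_ring n\<^esub> \<phi> (dual_var b)"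
      using deg hom_act by (metis dual_var_closed)
    then have "trunc_coeff n (\<phi> (dual_var a)) c =
        trunc_coeff n (trunc n (Poly_Mapping.single (unit_exp j) 1) \<otimes>\<^bsub>trunc_ring n\<^esub> \<phi> (dual_var b)) (unit_exp i + c)"
      using trunc_coeff_mult_single_add[of "\<phi> (dual_var a)" n "unit_exp i" c 1] Suc.prems deg by (simp add: unit_exp)
    also have "\<dots> = 0"
    \<comment> \<open>If \<open>c\<close> does not involve \<open>j\<close>, then neither does
      \<open>unit_exp i + c\<close>, as \<open>i \<noteq> j\<close>, and no multiple of
      \<open>x_j\<close> has this coefficient. Otherwise dividing by \<open>x_j\<close> leads to an
      exponent of the same degree as \<open>c\<close>, covered by the induction hypothesis for
      \<open>b\<close>.\<close>
    proof (cases "Poly_Mapping.lookup c j = 0")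
      case True
      then show ?thesis
        using Suc.prems deg \<open>i \<noteq> j\<close>
        by (intro trunc_coeff_mult_single_eq_0 not_unit) (auto simp: unit_exp unit_exp_def lookup_add lookup_single)
    next
      case False
      define c' where "c' = c - unit_exp j"
      have c: "c = unit_exp j + c'"
        unfolding c'_def unit_exp_def using False by (intro single_add_diff_cancel[symmetric]) simp
      then have "unit_exp i + c = unit_exp j + (unit_exp i + c')" by (simp add: ac_simps)
      moreover have "trunc_coeff n (\<phi> (dual_var b)) (unit_exp i + c') = 0"
        using Suc.prems c by (intro IH) (simp add: unit_exp)
      ultimately show ?thesis
        using trunc_coeff_mult_single_add[of "\<phi> (dual_var b)" n "unit_exp j" "unit_exp i + c'" 1] Suc.prems deg c
        by (simp add: unit_exp)
    qed
    finally show ?case .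
  qed
qed

text \<open>Such an element is a proper monomial multiple of some \<open>dual_var\<close> of degree
  \<open>n - 1\<close>, whose image already has order \<open>n - 1\<close> and is therefore killed
  by the maximal ideal.\<close>

lemma hom_dual_var_eq_0:
  assumes "exp_degree a < n - 1"
  shows "\<phi> (dual_var a) = \<zero>\<^bsub>trunc_ring n\<^esub>"
proof -
  obtain v :: 'v where True by simp
  \<comment> \<open>Any variable can be used to fill the degree of \<open>a\<close> up to
    \<open>n - 1\<close>.\<close>
  define d where "d = Poly_Mapping.single v (n - 1 - exp_degree a)"
  have d: "exp_degree (d + a) = n - 1" "exp_degree d \<ge> 1"
    using assms by (auto simp: d_def)
  then have da: "exp_degree (d + a) < n" using n_pos by simp
  have "dual_var a = act (Poly_Mapping.single d 1) (dual_var (d + a))"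
    using act_single_dual_var_add[OF da, of 1] da by (simp add: mpoly_const_def)
  then have "\<phi> (dual_var a) = trunc n (Poly_Mapping.single d 1) \<otimes>\<^bsub>trunc_ring n\<^esub> \<phi> (dual_var (d + a))"
    using hom_act[OF dual_var_closed[OF da]] by simp
  also have "\<dots> = \<zero>\<^bsub>trunc_ring n\<^esub>"
    using d da by (intro trunc_mult_eq_0[where i = 1] single_in_order_ideal trunc_coeff_hom_dual_var_top) auto
  finally show ?thesis .
qed

lemma trunc_coeff_hom:
  assumes "z \<in> carrier M" "exp_degree c < n - 1"
  shows "trunc_coeff n (\<phi> z) c = 0"
  using assms(1)
proof (induction rule: dual_var_induct)
  case zero
  then show ?case using assms(2) by (simp add: hom_zero)
next
  case (add x y)
  then show ?case using assms(2) by (simp add: hom_add trunc_coeff_add)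
next
  case (dual_var a d)
  have "trunc_coeff n (\<phi> (dual_var a)) c = 0"
  proof (cases "exp_degree a = n - 1")
    case True
    then show ?thesis using assms(2) by (rule trunc_coeff_hom_dual_var_top)
  next
    case False
    with dual_var have "exp_degree a < n - 1" by simp
    then show ?thesis using assms(2) by (simp add: hom_dual_var_eq_0 trunc_ring_zero)
  qed
  then show ?case
    using assms(2) dual_var trunc_coeff_mult_single_add[of "\<phi> (dual_var a)" n 0 c d]
    by (simp add: hom_act mpoly_const_def)
qed

text \<open>The values of \<phi> have order at least \<open>n - 1\<close>, and one more factor from
  the maximal ideal reaches order \<open>n\<close>. This is the annihilation statement, evaluated at
  \<open>z\<close>.\<close>

lemma order_ideal_mult_hom:
  assumes "z \<in> carrier M" "p \<in> order_ideal 1"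
  shows "trunc n p \<otimes>\<^bsub>trunc_ring n\<^esub> \<phi> z = \<zero>\<^bsub>trunc_ring n\<^esub>"
  using assms by (intro trunc_mult_eq_0[where i = 1] trunc_coeff_hom) auto

text \<open>All other coefficients vanish anyway: the values of \<phi> have no terms below degree
  \<open>n - 1\<close>, and elements \<open>dual_var a\<close> of lower degree go to zero. It is the
  injectivity needed for the dimension count.\<close>

lemma hom_eq_0I:
  assumes "\<And>a b. exp_degree a = n - 1 \<Longrightarrow> exp_degree b = n - 1 \<Longrightarrow> trunc_coeff n (\<phi> (dual_var a)) b = 0"
    and "z \<in> carrier M"
  shows "\<phi> z = \<zero>\<^bsub>trunc_ring n\<^esub>"
  using assms(2)
proof (induction rule: dual_var_induct)
  case zero
  then show ?case by (simp add: hom_zero trunc_ring_zero)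
next
  case (add x y)
  then show ?case by (simp add: hom_add trunc_ring_zero)
next
  case (dual_var a d)
  have "\<phi> (dual_var a) = \<zero>\<^bsub>trunc_ring n\<^esub>"
  proof (cases "exp_degree a = n - 1")
    case True
    show ?thesis
    proof (rule trunc_ring_eqI)
      fix b :: "'v \<Rightarrow>\<^sub>0 nat" assume b: "exp_degree b < n"
      then have "trunc_coeff n (\<phi> (dual_var a)) b = 0"
        using True assms(1)[OF True, of b] trunc_coeff_hom[of "dual_var a" b] dual_var by fastforce
      with b show "trunc_coeff n (\<phi> (dual_var a)) b = trunc_coeff n \<zero>\<^bsub>trunc_ring n\<^esub> b"
        by (simp add: trunc_ring_zero)
    qed (use dual_var in \<open>simp_all add: trunc_ring_zero\<close>)
  next
    case False
    with dual_var show ?thesis by (intro hom_dual_var_eq_0) simp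
  qed
  with dual_var show ?case by (simp add: hom_act trunc_ring_zero)
qed

end

section \<open>The dimension of the dual of the envelope\<close>

text \<open>Extensional maps are equal once they agree on the carrier, so each axiom reduces to the
  corresponding pointwise one in \<open>N\<close>.\<close>

lemma module_Hom_module:
  assumes M: "Module.module R M" and N: "Module.module R N"
  shows "Module.module R (Hom_module R M N)"
proof -
  interpret M: Module.module R M by fact
  interpret N: Module.module R N by fact
  let ?H = "Hom_module R M N"
  have carrier: "f \<in> carrier ?H \<longleftrightarrow> f \<in> carrier M \<rightarrow> carrier N \<and>
      (\<forall>x\<in>carrier M. \<forall>y\<in>carrier M. f (x \<oplus>\<^bsub>M\<^esub> y) = f x \<oplus>\<^bsub>N\<^esub> f y) \<and>
      (\<forall>r\<in>carrier R. \<forall>x\<in>carrier M. f (r \<odot>\<^bsub>M\<^esub> x) = r \<odot>\<^bsub>N\<^esub> f x) \<and> f \<in> extensional (carrier M)" for f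
    by (auto simp: Hom_module_def LinearCombinations.module_hom_def)
  have simps: "\<zero>\<^bsub>?H\<^esub> = (\<lambda>x\<in>carrier M. \<zero>\<^bsub>N\<^esub>)" "f \<oplus>\<^bsub>?H\<^esub> g = (\<lambda>x\<in>carrier M. f x \<oplus>\<^bsub>N\<^esub> g x)"
    "r \<odot>\<^bsub>?H\<^esub> f = (\<lambda>x\<in>carrier M. r \<odot>\<^bsub>N\<^esub> f x)" for f g r
    by (simp_all add: Hom_module_def)
  have val: "f x \<in> carrier N" if "f \<in> carrier ?H" "x \<in> carrier M" for f x
    using that carrier by auto
  have ext: "f = g" if "f \<in> carrier ?H" "g \<in> carrier ?H" "\<And>x. x \<in> carrier M \<Longrightarrow> f x = g x" for f g
    using that carrier by (intro extensionalityI[of f "carrier M" g]) auto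
  have add: "f \<oplus>\<^bsub>?H\<^esub> g \<in> carrier ?H" if "f \<in> carrier ?H" "g \<in> carrier ?H" for f g
    using that val[OF that(1)] val[OF that(2)] unfolding carrier simps
    by (auto simp: N.smult_r_distr N.M.a_ac)
  have smult: "r \<odot>\<^bsub>?H\<^esub> f \<in> carrier ?H" if r: "r \<in> carrier R" and f: "f \<in> carrier ?H" for r f
    using f val[OF f] r unfolding carrier simps
    by (auto simp: N.smult_r_distr M.R.m_comm simp flip: N.smult_assoc1)
  have zero: "\<zero>\<^bsub>?H\<^esub> \<in> carrier ?H"
    unfolding carrier simps by auto
  show ?thesis
  proof (intro module.intro module_axioms.intro M.R.is_cring abelian_groupI)
    fix f assume f: "f \<in> carrier ?H"
    have "(\<ominus>\<^bsub>R\<^esub> \<one>\<^bsub>R\<^esub>) \<odot>\<^bsub>?H\<^esub> f \<oplus>\<^bsub>?H\<^esub> f = \<zero>\<^bsub>?H\<^esub>"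
      using f val[OF f] by (intro ext add smult zero) (auto simp: simps N.smult_l_minus N.M.l_neg)
    then show "\<exists>g\<in>carrier ?H. g \<oplus>\<^bsub>?H\<^esub> f = \<zero>\<^bsub>?H\<^esub>"
      using f by (intro bexI[of _ "(\<ominus>\<^bsub>R\<^esub> \<one>\<^bsub>R\<^esub>) \<odot>\<^bsub>?H\<^esub> f"] smult) auto
  next
    fix f g k assume f: "f \<in> carrier ?H" and g: "g \<in> carrier ?H" and k: "k \<in> carrier ?H"
    show "(f \<oplus>\<^bsub>?H\<^esub> g) \<oplus>\<^bsub>?H\<^esub> k = f \<oplus>\<^bsub>?H\<^esub> (g \<oplus>\<^bsub>?H\<^esub> k)"
      by (intro ext add f g k) (simp add: simps val f g k N.M.a_assoc)
  next
    fix f g assume f: "f \<in> carrier ?H" and g: "g \<in> carrier ?H"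
    show "f \<oplus>\<^bsub>?H\<^esub> g = g \<oplus>\<^bsub>?H\<^esub> f"
      by (intro ext add f g) (simp add: simps val f g N.M.a_comm)
    show "r \<odot>\<^bsub>?H\<^esub> (f \<oplus>\<^bsub>?H\<^esub> g) = r \<odot>\<^bsub>?H\<^esub> f \<oplus>\<^bsub>?H\<^esub> r \<odot>\<^bsub>?H\<^esub> g" if r: "r \<in> carrier R" for r
      by (intro ext add smult f g r) (simp add: simps val f g r N.smult_r_distr)
  next
    fix f assume f: "f \<in> carrier ?H"
    show "\<zero>\<^bsub>?H\<^esub> \<oplus>\<^bsub>?H\<^esub> f = f"
      by (intro ext add zero f) (simp add: simps val f)
    show "\<one>\<^bsub>R\<^esub> \<odot>\<^bsub>?H\<^esub> f = f"
      by (intro ext smult f M.R.one_closed) (simp add: simps val f)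
    fix r s assume r: "r \<in> carrier R" and s: "s \<in> carrier R"
    show "(r \<oplus>\<^bsub>R\<^esub> s) \<odot>\<^bsub>?H\<^esub> f = r \<odot>\<^bsub>?H\<^esub> f \<oplus>\<^bsub>?H\<^esub> s \<odot>\<^bsub>?H\<^esub> f"
      by (intro ext add smult f r s M.R.a_closed) (simp add: simps val f r s N.smult_l_distr)
    show "(r \<otimes>\<^bsub>R\<^esub> s) \<odot>\<^bsub>?H\<^esub> f = r \<odot>\<^bsub>?H\<^esub> (s \<odot>\<^bsub>?H\<^esub> f)"
      by (intro ext smult f r s M.R.m_closed) (simp add: simps val f r s N.smult_assoc1)
  qed (use add smult zero in auto)
qed

lemma module_restrict_scalars:
  assumes K: "cring K" and \<phi>: "\<phi> \<in> Ring.ring_hom K R" and M: "Module.module R M"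
  shows "Module.module K (restrict_scalars \<phi> M)"
proof -
  interpret M: Module.module R M by fact
  interpret K: cring K by fact
  have "abelian_group (restrict_scalars \<phi> M)"
    by (rule abelian_groupI)
      (auto simp: restrict_scalars_def M.M.a_ac intro: bexI[of _ "\<ominus>\<^bsub>M\<^esub> _"] M.M.l_neg)
  then show ?thesis
    using \<phi>
    by (intro module.intro K module_axioms.intro)
      (auto simp: restrict_scalars_def Ring.ring_hom_def Pi_iff M.smult_l_distr M.smult_r_distr M.smult_assoc1)
qed

text \<open>Applying \<open>x i\<close> to a combination of the \<open>b j\<close> returns its
  coefficient at \<open>b i\<close>, which gives independence. Subtracting from \<open>v\<close> the
  combination with coefficients \<open>x i v\<close> leaves a vector killed by every
  \<open>x i\<close>, hence zero, which gives spanning.\<close>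

lemma (in vectorspace) dim_eq_card_dual_family:
  assumes I: "finite I" and b: "\<And>i. i \<in> I \<Longrightarrow> b i \<in> carrier V"
    and x: "\<And>i. i \<in> I \<Longrightarrow> x i \<in> LinearCombinations.module_hom K V (regular_module K)"
    and xb: "\<And>i j. i \<in> I \<Longrightarrow> j \<in> I \<Longrightarrow> x i (b j) = (if i = j then \<one>\<^bsub>K\<^esub> else \<zero>\<^bsub>K\<^esub>)"
    and ker: "\<And>v. v \<in> carrier V \<Longrightarrow> (\<And>i. i \<in> I \<Longrightarrow> x i v = \<zero>\<^bsub>K\<^esub>) \<Longrightarrow> v = \<zero>\<^bsub>V\<^esub>"
  shows "fin_dim \<and> dim = card I"
proof -
  have inj: "inj_on b I"
  proof (rule inj_onI)
    fix i j assume "i \<in> I" "j \<in> I" "b i = b j"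
    then show "i = j" using xb[of i i] xb[of i j] by (auto split: if_splits)
  qed
  have bI: "b ` I \<subseteq> carrier V" using b by auto
  have x_lincomb: "x i (lincomb a (b ` J)) = (if i \<in> J then a (b i) else \<zero>\<^bsub>K\<^esub>)"
    if "i \<in> I" "J \<subseteq> I" "a \<in> b ` I \<rightarrow> carrier K" for i J a
  proof -
    interpret x: mod_hom K V "regular_module K" "x i"
      using x[OF that(1)] module_axioms module_regular_module[OF is_cring]
      by (intro mod_hom.intro mod_hom_axioms.intro)
    have "finite J" using that(2) I finite_subset by auto
    then show ?thesis using that(2)
    proof (induction J rule: finite_induct)
      case empty
      then show ?case using x.f0_is_0 by (simp add: lincomb_def)
    next
      case (insert j J)
      then have j: "j \<in> I" "b j \<notin> b ` J" using inj by (auto simp: inj_on_def)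
      have a: "a \<in> b ` J \<union> {b j} \<rightarrow> carrier K" "a \<in> b ` J \<rightarrow> carrier K" "a (b j) \<in> carrier K"
        using that(3) insert.prems by auto
      have "lincomb a (b ` J \<union> {b j}) = a (b j) \<odot>\<^bsub>V\<^esub> b j \<oplus>\<^bsub>V\<^esub> lincomb a (b ` J)"
        using insert j b a(1) by (intro lincomb_insert) auto
      moreover have "lincomb a (b ` J) \<in> carrier V"
        using insert b a(2) by (intro lincomb_closed) auto
      ultimately show ?case
        using insert j b a(3) xb[OF that(1) j(1)] funcset_mem[OF that(3) imageI[OF that(1)]] by auto
    qed
  qed
  have "lin_indpt (b ` I)"
  proof (rule finite_lin_indpt2)
    fix a assume a: "a \<in> b ` I \<rightarrow> carrier K" "lincomb a (b ` I) = \<zero>\<^bsub>V\<^esub>"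
    have "a (b i) = \<zero>\<^bsub>K\<^esub>" if i: "i \<in> I" for i
    proof -
      interpret x: mod_hom K V "regular_module K" "x i"
        using x[OF i] module_axioms module_regular_module[OF is_cring]
        by (intro mod_hom.intro mod_hom_axioms.intro)
      show ?thesis using x_lincomb[OF i order_refl a(1)] a(2) i x.f0_is_0 by simp
    qed
    then show "\<forall>v\<in>b ` I. a v = \<zero>\<^bsub>K\<^esub>" by auto
  qed (use I b in auto)
  moreover have gen: "span (b ` I) = carrier V"
  proof
    show "span (b ` I) \<subseteq> carrier V" using bI by (rule span_is_subset2)
    show "carrier V \<subseteq> span (b ` I)"
    proof
      fix v assume v: "v \<in> carrier V"
      \<comment> \<open>Coefficients in \<open>lincomb\<close> are indexed by the vectors
        themselves, so the index has to be recovered by inverting \<open>b\<close>.\<close>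
      define a where "a w = x (the_inv_into I b w) v" for w
      have a_b: "a (b i) = x i v" if "i \<in> I" for i
        using that inj by (simp add: a_def the_inv_into_f_f)
      have x_v: "x i v \<in> carrier K" if "i \<in> I" for i
        using LinearCombinations.module_hom_closed[OF x[OF that]] v by auto
      have a: "a \<in> b ` I \<rightarrow> carrier K" using a_b x_v by auto
      then have l: "lincomb a (b ` I) \<in> carrier V" using bI by auto
      have "v \<ominus>\<^bsub>V\<^esub> lincomb a (b ` I) = \<zero>\<^bsub>V\<^esub>"
      proof (rule ker)
        fix i assume i: "i \<in> I"
        interpret x: mod_hom K V "regular_module K" "x i"
          using x[OF i] module_axioms module_regular_module[OF is_cring]
          by (intro mod_hom.intro mod_hom_axioms.intro)
        have "x i (v \<ominus>\<^bsub>V\<^esub> lincomb a (b ` I)) = x i v \<ominus>\<^bsub>regular_module K\<^esub> x i v"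
          using x_lincomb[OF i order_refl a] v l i a_b by simp
        also have "\<dots> = \<zero>\<^bsub>regular_module K\<^esub>"
          using x_v[OF i] by (simp add: x.N.M.r_neg a_minus_def del: regular_module_simps(2,3))
        finally show "x i (v \<ominus>\<^bsub>V\<^esub> lincomb a (b ` I)) = \<zero>\<^bsub>K\<^esub>" by simp
      qed (use v l in auto)
      then have "v = lincomb a (b ` I)" using v l by simp
      then show "v \<in> span (b ` I)" using a I by (auto simp: span_def)
    qed
  qed
  ultimately have "basis (b ` I)" using bI by (simp add: basis_def)
  then have "dim = card (b ` I)" using I by (intro dim_basis) auto
  moreover have "fin_dim" unfolding fin_dim_def using I bI gen by (intro exI[of _ "b ` I"]) auto
  ultimately show ?thesis using inj by (simp add: card_image)
qed

section \<open>A basis of the dual of the envelope\<close>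

context trunc_envelope_dual
begin

abbreviation dual where "dual \<equiv> Hom_module (trunc_ring n) M (regular_module (trunc_ring n))"

abbreviation dual_space where
  "dual_space \<equiv> restrict_scalars (\<lambda>c. trunc n (mpoly_const c)) dual"

lemma functional:
  assumes "CARD('v) \<ge> 2" "\<phi> \<in> carrier dual"
  shows "trunc_envelope_functional n M y0 h \<phi>"
  by (intro trunc_envelope_functional.intro trunc_envelope_functional_axioms.intro
      trunc_envelope_dual_axioms) (use assms in \<open>simp_all add: Hom_module_def\<close>)

lemma dual_act_eq_0:
  assumes "CARD('v) \<ge> 2" "\<phi> \<in> carrier dual" "p \<in> order_ideal 1"
  shows "trunc n p \<odot>\<^bsub>dual\<^esub> \<phi> = \<zero>\<^bsub>dual\<^esub>"
  using trunc_envelope_functional.order_ideal_mult_hom[OF functional[OF assms(1,2)] _ assms(3)]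
  by (auto simp: Hom_module_def intro!: restrict_ext)

text \<open>For \<open>a\<close> and \<open>b\<close> of degree \<open>n - 1\<close> this is the
  elementary map that takes the coordinate along \<open>dual_var a\<close> to the multiple of the
  socle monomial \<open>x^b\<close>.\<close>

definition dual_basis :: "('v \<Rightarrow>\<^sub>0 nat) \<times> ('v \<Rightarrow>\<^sub>0 nat) \<Rightarrow> 'b \<Rightarrow> ('v, 'k) mpoly set" where
  "dual_basis = (\<lambda>(a, b). \<lambda>z\<in>carrier M. trunc n (Poly_Mapping.single b (socle_coeff a z)))"

text \<open>On the source side \<open>p\<close> changes the coordinate by its constant term, and on
  the target side it acts on a monomial of degree \<open>n - 1\<close> by that same
  constant.\<close>

lemma dual_basis_in_dual:
  assumes "exp_degree a = n - 1" "exp_degree b = n - 1"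
  shows "dual_basis (a, b) \<in> carrier dual"
proof -
  have "trunc n (Poly_Mapping.single b (socle_coeff a (act p z))) =
      trunc n (p * Poly_Mapping.single b (socle_coeff a z))" if z: "z \<in> carrier M" for p z
  proof -
    let ?c = "mpoly_const (Poly_Mapping.lookup p 0) :: ('v, 'k) mpoly"
    have "p - ?c \<in> order_ideal 1"
      by (simp add: order_ideal_def mpoly_const_def lookup_minus)
    then have "(p - ?c) * Poly_Mapping.single b (socle_coeff a z) \<in> order_ideal (1 + (n - 1))"
      using assms(2) by (intro mult_in_order_ideal single_in_order_ideal) simp_all
    then have "trunc n ((p - ?c) * Poly_Mapping.single b (socle_coeff a z)) = trunc n 0"
      using n_pos by (simp add: trunc_eq_0_iff)
    then have "trunc n (p * Poly_Mapping.single b (socle_coeff a z)) =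
        trunc n (?c * Poly_Mapping.single b (socle_coeff a z))"
      by (simp add: trunc_eq_iff left_diff_distrib lookup_minus)
    then show ?thesis
      using z assms(1) by (simp add: socle_coeff_act mpoly_const_def mult_single)
  qed
  then show ?thesis
    using assms
    by (auto simp: Hom_module_def LinearCombinations.module_hom_def dual_basis_def
        socle_coeff_add single_add carrier_trunc_ring)
qed

lemma vectorspace_dual: "vectorspace class_ring dual_space"
proof -
  have const: "mpoly_const (c + d) = mpoly_const c + (mpoly_const d :: ('v, 'k) mpoly)"
    "mpoly_const (c * d) = mpoly_const c * (mpoly_const d :: ('v, 'k) mpoly)" for c d
    by (simp_all add: mpoly_const_def single_add mult_single)
  have "(\<lambda>c. trunc n (mpoly_const c :: ('v, 'k) mpoly)) \<in> Ring.ring_hom class_ring (trunc_ring n)"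
    by (rule ring_hom_memI) (simp_all add: const trunc_ring_one mpoly_const_def[of 1])
  then have "Module.module class_ring dual_space"
    by (rule module_restrict_scalars[OF class_cring.is_cring _
          module_Hom_module[OF module module_regular_module[OF cring_trunc_ring]]])
  then show ?thesis
    by (intro vectorspace.intro class_field)
qed

text \<open>The functionals taking \<phi> to the coefficient at \<open>b\<close> of its value on
  \<open>dual_var a\<close> are dual to \<open>dual_basis\<close>, and by \<open>hom_eq_0I\<close>
  they have no common kernel.\<close>

lemma dim_dual:
  assumes card_vars: "CARD('v) \<ge> 2"
  shows "vectorspace.fin_dim class_ring dual_space \<and>
    vectorspace.dim class_ring dual_space = card {a :: 'v \<Rightarrow>\<^sub>0 nat. exp_degree a = n - 1} ^ 2"
proof -
  let ?T = "{a :: 'v \<Rightarrow>\<^sub>0 nat. exp_degree a = n - 1}"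
  interpret V: vectorspace class_ring dual_space by (rule vectorspace_dual)
  define x :: "('v \<Rightarrow>\<^sub>0 nat) \<times> ('v \<Rightarrow>\<^sub>0 nat) \<Rightarrow> ('b \<Rightarrow> ('v, 'k) mpoly set) \<Rightarrow> 'k"
    where "x = (\<lambda>(a, b) \<phi>. trunc_coeff n (\<phi> (dual_var a)) b)"
  have less: "exp_degree a < n" if "a \<in> ?T" for a using that n_pos by simp
  have carrier: "carrier dual_space = carrier dual" by (simp add: restrict_scalars_def)
  have "V.fin_dim \<and> V.dim = card (?T \<times> ?T)"
  proof (rule V.dim_eq_card_dual_family[where b = dual_basis and x = x])
    show "finite (?T \<times> ?T)" by (simp add: finite_exp_degree_eq)
    show "dual_basis i \<in> carrier dual_space" if "i \<in> ?T \<times> ?T" for i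
      using that dual_basis_in_dual by (auto simp: carrier)
    show "x i \<in> LinearCombinations.module_hom class_ring dual_space (regular_module class_ring)"
      if i: "i \<in> ?T \<times> ?T" for i
    proof -
      obtain a b where ab: "i = (a, b)" "a \<in> ?T" "b \<in> ?T" using i by auto
      have val: "\<phi> (dual_var a) \<in> carrier (trunc_ring n)" if "\<phi> \<in> carrier dual" for \<phi>
        using that less[OF ab(2)] by (auto simp: Hom_module_def LinearCombinations.module_hom_def)
      have "x i (\<phi> \<oplus>\<^bsub>dual\<^esub> \<psi>) = x i \<phi> + x i \<psi>" if "\<phi> \<in> carrier dual" "\<psi> \<in> carrier dual" for \<phi> \<psi>
      proof -
        have "(\<phi> \<oplus>\<^bsub>dual\<^esub> \<psi>) (dual_var a) = \<phi> (dual_var a) \<oplus>\<^bsub>trunc_ring n\<^esub> \<psi> (dual_var a)"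
          using less[OF ab(2)] by (simp add: Hom_module_def)
        then show ?thesis
          using val that less[OF ab(3)] by (simp add: x_def ab(1) trunc_coeff_add)
      qed
      moreover have "x i (c \<odot>\<^bsub>dual_space\<^esub> \<phi>) = c * x i \<phi>" if "\<phi> \<in> carrier dual" for c \<phi>
      proof -
        have "(c \<odot>\<^bsub>dual_space\<^esub> \<phi>) (dual_var a) =
            trunc n (Poly_Mapping.single 0 c) \<otimes>\<^bsub>trunc_ring n\<^esub> \<phi> (dual_var a)"
          using less[OF ab(2)] by (simp add: Hom_module_def restrict_scalars_def mpoly_const_def)
        then show ?thesis
          using trunc_coeff_mult_single_add[OF val[OF that], of 0 b c] less[OF ab(3)]
          by (simp add: x_def ab(1))
      qed
      ultimately show ?thesis
        by (auto simp: LinearCombinations.module_hom_def carrier restrict_scalars_def)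
    qed
    show "x i (dual_basis j) = (if i = j then \<one>\<^bsub>class_ring\<^esub> else \<zero>\<^bsub>class_ring\<^esub>)"
      if "i \<in> ?T \<times> ?T" "j \<in> ?T \<times> ?T" for i j
      using that less by (auto simp: x_def dual_basis_def socle_coeff_dual_var lookup_single when_def split: if_splits)
    show "\<phi> = \<zero>\<^bsub>dual_space\<^esub>"
      if \<phi>: "\<phi> \<in> carrier dual_space" and x0: "\<And>i. i \<in> ?T \<times> ?T \<Longrightarrow> x i \<phi> = \<zero>\<^bsub>class_ring\<^esub>" for \<phi>
    proof -
      have "\<phi> z = \<zero>\<^bsub>trunc_ring n\<^esub>" if "z \<in> carrier M" for z
      proof (rule trunc_envelope_functional.hom_eq_0I[OF functional[OF card_vars] _ that])
        show "\<phi> \<in> carrier dual" using \<phi> by (simp add: carrier)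
        show "trunc_coeff n (\<phi> (dual_var a)) b = 0" if "exp_degree a = n - 1" "exp_degree b = n - 1" for a b
          using x0[of "(a, b)"] that by (simp add: x_def)
      qed
      moreover have "\<phi> \<in> extensional (carrier M)"
        using \<phi>[unfolded carrier] by (simp add: Hom_module_def)
      ultimately show ?thesis
        by (intro extensionalityI[of _ "carrier M"]) (simp_all add: restrict_scalars_def Hom_module_def)
    qed
  qed
  then show ?thesis by (simp add: power2_eq_square card_cartesian_product)
qed

end

section \<open>Transfer to the given ring and envelope\<close>

theorem proposition4p3:
  fixes e n :: nat
    and k :: "'k::field ring"
    and S :: "('v::finite, 'k) mpoly ring"
    and R :: "('v, 'k) mpoly set ring"
    and E :: "(('v, 'k) mpoly set, 'b) module"
  assumes e: "CARD('v) = e" "e \<ge> 2" and n: "n \<ge> 2"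
    and k: "k = class_ring"
    and S: "S = mpoly_ring"
    and \<nn>: "\<nn> = genideal S (range mpoly_var)"
    and I: "I = \<nn> [^]\<^bsub>ideals_set S\<^esub> n"
    and R: "R = S Quot I"
    and \<mm>: "\<mm> = (\<lambda>p. I +>\<^bsub>S\<^esub> p) ` \<nn>"
    and E: "injective_envelope R (residue_module R \<mm>) E"
    and E_dual: "E_dual = Hom_module R E (regular_module R)"
    and V: "V = restrict_scalars (\<lambda>c. I +>\<^bsub>S\<^esub> mpoly_const c) E_dual"
  shows "(\<forall>a \<in> \<mm>. \<forall>\<phi> \<in> carrier E_dual. a \<odot>\<^bsub>E_dual\<^esub> \<phi> = \<zero>\<^bsub>E_dual\<^esub>) \<and>
    vectorspace.fin_dim k V \<and>
    vectorspace.dim k V = ((e + n - 2) choose (n - 1)) ^ 2"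
proof -
  have \<nn>': "\<nn> = order_ideal 1"
    unfolding \<nn> S by (rule genideal_mpoly_var)
  then have I': "I = order_ideal n"
    unfolding I S by (simp only: order_ideal_1_pow)
  then have R': "R = trunc_ring n" and coset: "(\<lambda>p. I +>\<^bsub>S\<^esub> p) = trunc n"
    by (simp_all add: R S trunc_ring_def trunc_def[abs_def])
  have \<mm>': "\<mm> = trunc n ` order_ideal 1"
    unfolding \<mm> coset \<nn>' ..
  let ?K = "residue_module (trunc_ring n :: ('v, 'k) mpoly set ring) (trunc n ` order_ideal 1)"
  obtain u where u: "u \<in> carrier ?K" "u \<noteq> \<zero>\<^bsub>?K\<^esub>" "carrier ?K = range (\<lambda>p. trunc n p \<odot>\<^bsub>?K\<^esub> u)"
      "\<And>p. p \<in> order_ideal 1 \<Longrightarrow> trunc n p \<odot>\<^bsub>?K\<^esub> u = \<zero>\<^bsub>?K\<^esub>"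
    using residue_module_generator[of n, where 'v = 'v and 'k = 'k] n by fastforce
  obtain y0 where "trunc_envelope n E y0"
    using trunc_envelope_of_injective_envelope[OF E[unfolded R' \<mm>'] u] by blast
  then interpret trunc_envelope n E y0 .
  obtain h where "h \<in> LinearCombinations.module_hom (trunc_ring n) (dual_module n) E"
    "h (\<lambda>p. Poly_Mapping.lookup p 0) = y0"
    using dual_module_hom_exists n by auto
  then interpret trunc_envelope_dual n E y0 h
    by unfold_locales (use n in auto)
  have E_dual': "E_dual = dual" and V': "V = dual_space"
    by (simp_all add: E_dual V R' coset[THEN fun_cong])
  have card: "CARD('v) \<ge> 2" using e by simp
  \<comment> \<open>The count in degree \<open>n - 1\<close> is
    \<open>(e + (n - 1) - 1) choose (n - 1)\<close>; the truncated subtractions are exact because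
    \<open>n \<ge> 2\<close>.\<close>
  have "card {a :: 'v \<Rightarrow>\<^sub>0 nat. exp_degree a = n - 1} = (e + n - 2) choose (n - 1)"
    using e n by (simp add: card_exp_degree_eq)
  then show ?thesis
    using dim_dual[OF card] dual_act_eq_0[OF card] unfolding E_dual' V' \<mm>' k by auto
qed

end
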